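(* Let $d,e\in\mathbb N$, $k$ a field, $\Lambda$ a finitely generated $k$-algebra and $M\in\mathrm{Mod}_\Lambda(d+e)(k)$, i.e. a $\Lambda$-module structure on $k^{d+e}$. Let $U\in\mathrm{Gr}_\Lambda(d,M)(K)$, for a field extension $K$ of $k$. Then $$T_U\mathrm{Gr}_\Lambda(d,M)\cong\operatorname{Hom}_{\Lambda\otimes_kK}\bigl(U,(M\otimes_kK)/U\bigr).$$
   Context: $\mathrm{Mod}_\Lambda(d)$ is the affine $k$-scheme $R\mapsto\operatorname{Hom}_{R\text{-alg}}(\Lambda\otimes_kR,\operatorname{End}(R^d))$ of $\Lambda$-module structures. $\mathrm{Gr}_\Lambda(d,M)$ is the $k$-scheme whose $R$-points ($R$ a commutative $k$-algebra) are the $\Lambda\otimes_kR$-submodules $U$ of $M\otimes_kR$ that are, as $R$-modules, direct summands of $R^{d+e}$ of rank $d$. For a $K$-valued point $x$ of a $k$-scheme $X$, $T_xX$ is the $K$-vector space given by the fibre over $x$ of $X(K[\varepsilon])\to X(K)$, $\varepsilon^2=0$, $\varepsilon\mapsto0$. *)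

theory Defs
  imports "HOL-Algebra.Ideal" "Jordan_Normal_Form.VS_Connect"
begin

section \<open>Finitely generated associative algebras\<close>

text \<open>
  The locale \<open>algebra\<close> of HOL-Algebra requires a commutative multiplication; here \<open>A\<close> is
  associative and unital, not necessarily commutative, and possibly zero.
\<close>

locale assoc_algebra = Module.module R A + Ring.ring A for R and A (structure) +
  assumes smult_mult_left:
      "\<lbrakk>a \<in> carrier R; x \<in> carrier A; y \<in> carrier A\<rbrakk> \<Longrightarrow> (a \<odot> x) \<otimes> y = a \<odot> (x \<otimes> y)"
    and smult_mult_right:
      "\<lbrakk>a \<in> carrier R; x \<in> carrier A; y \<in> carrier A\<rbrakk> \<Longrightarrow> x \<otimes> (a \<odot> y) = a \<odot> (x \<otimes> y)"

inductive_set generated_subalgebra :: "('k, 'a) module \<Rightarrow> 'a set \<Rightarrow> 'a set"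
  for A :: "('k, 'a) module" and S :: "'a set" where
  incl: "x \<in> S \<Longrightarrow> x \<in> generated_subalgebra A S"
| zero: "\<zero>\<^bsub>A\<^esub> \<in> generated_subalgebra A S"
| one: "\<one>\<^bsub>A\<^esub> \<in> generated_subalgebra A S"
| add: "\<lbrakk>x \<in> generated_subalgebra A S; y \<in> generated_subalgebra A S\<rbrakk>
    \<Longrightarrow> x \<oplus>\<^bsub>A\<^esub> y \<in> generated_subalgebra A S"
| mult: "\<lbrakk>x \<in> generated_subalgebra A S; y \<in> generated_subalgebra A S\<rbrakk>
    \<Longrightarrow> x \<otimes>\<^bsub>A\<^esub> y \<in> generated_subalgebra A S"
| smult: "x \<in> generated_subalgebra A S \<Longrightarrow> c \<odot>\<^bsub>A\<^esub> x \<in> generated_subalgebra A S"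

definition finitely_generated_algebra :: "('k::field, 'a) module \<Rightarrow> bool" where
  "finitely_generated_algebra A \<longleftrightarrow> assoc_algebra class_ring A \<and>
     (\<exists>S. finite S \<and> S \<subseteq> carrier A \<and> generated_subalgebra A S = carrier A)"


section \<open>Module structures and their base change\<close>

text \<open>
  The set \<open>Mod\<^sub>\<Lambda>(n)(k)\<close> of \<open>k\<close>-algebra homomorphisms from \<open>\<Lambda>\<close> to \<open>End(k\<^sup>n)\<close>, the latter being
  the algebra of \<open>n\<close> by \<open>n\<close> matrices acting on column vectors.
\<close>

definition Mod_points :: "('k::field, 'l) module \<Rightarrow> nat \<Rightarrow> ('l \<Rightarrow> 'k mat) set" where
  "Mod_points \<Lambda> n =
     {\<rho> \<in> Ring.ring_hom \<Lambda> (ring_mat TYPE('k) n ()).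
        \<forall>c. \<forall>x \<in> carrier \<Lambda>. \<rho> (c \<odot>\<^bsub>\<Lambda>\<^esub> x) = c \<cdot>\<^sub>m \<rho> x}"

text \<open>
  A commutative \<open>k\<close>-algebra \<open>R\<close> is a type \<open>'r\<close> of class \<open>comm_ring_1\<close> with a structure map
  \<open>\<phi> :: 'k \<Rightarrow> 'r\<close>. Every element of \<open>\<Lambda> \<otimes>\<^sub>k R\<close> is a finite sum of pure tensors \<open>l \<otimes> r\<close>. We represent
  it by the list of the pairs \<open>(l, r)\<close>; one element has many representatives, but they all act in
  the same way on \<open>M \<otimes>\<^sub>k R = R\<^sup>n\<close>.
\<close>

abbreviation tensor_reps :: "('k, 'l) module \<Rightarrow> ('l \<times> 'r) list set" where
  "tensor_reps \<Lambda> \<equiv> lists (carrier \<Lambda> \<times> UNIV)"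

primrec tensor_act ::
  "nat \<Rightarrow> ('k \<Rightarrow> 'r::comm_ring_1) \<Rightarrow> ('l \<Rightarrow> 'k mat) \<Rightarrow> ('l \<times> 'r) list \<Rightarrow> 'r vec \<Rightarrow> 'r vec" where
  "tensor_act n \<phi> \<rho> [] v = 0\<^sub>v n"
| "tensor_act n \<phi> \<rho> (p # t) v =
     snd p \<cdot>\<^sub>v (map_mat \<phi> (\<rho> (fst p)) *\<^sub>v v) + tensor_act n \<phi> \<rho> t v"

definition tensor_submodule ::
  "('k, 'l) module \<Rightarrow> nat \<Rightarrow> ('k \<Rightarrow> 'r::comm_ring_1) \<Rightarrow> ('l \<Rightarrow> 'k mat) \<Rightarrow> 'r vec set \<Rightarrow> bool" where
  "tensor_submodule \<Lambda> n \<phi> \<rho> U \<longleftrightarrow>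
     U \<subseteq> carrier_vec n \<and> 0\<^sub>v n \<in> U \<and> (\<forall>x \<in> U. \<forall>y \<in> U. x + y \<in> U) \<and>
     (\<forall>t \<in> tensor_reps \<Lambda>. \<forall>x \<in> U. tensor_act n \<phi> \<rho> t x \<in> U)"


section \<open>The functor of points of the module Grassmannian\<close>

definition direct_summand :: "nat \<Rightarrow> 'r::comm_ring_1 vec set \<Rightarrow> bool" where
  "direct_summand n U \<longleftrightarrow>
     LinearCombinations.submodule class_ring U (module_vec TYPE('r) n) \<and>
     (\<exists>W. LinearCombinations.submodule class_ring W (module_vec TYPE('r) n) \<and>
        U \<inter> W = {0\<^sub>v n} \<and> {x + y | x y. x \<in> U \<and> y \<in> W} = carrier_vec n)"

text \<open>
  A finitely generated projective module \<open>U\<close> has rank \<open>d\<close> if for every prime ideal \<open>P\<close> the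
  localisation \<open>U\<^sub>P\<close> is free of rank \<open>d\<close> over \<open>R\<^sub>P\<close>. After clearing denominators a basis of \<open>U\<^sub>P\<close>
  consists of images of elements \<open>u\<^sub>i\<close> of \<open>U\<close>, and the identities in \<open>U\<^sub>P\<close> and \<open>R\<^sub>P\<close> below hold up to a
  factor \<open>s \<notin> P\<close>.
\<close>

definition has_rank :: "nat \<Rightarrow> 'r::comm_ring_1 vec set \<Rightarrow> nat \<Rightarrow> bool" where
  "has_rank n U d \<longleftrightarrow> (\<forall>P :: 'r set. primeideal P class_ring \<longrightarrow>
     (\<exists>u. (\<forall>i < d. u i \<in> U) \<and>
        (\<forall>x \<in> U. \<exists>s c. s \<notin> P \<and> s \<cdot>\<^sub>v x = finsum_vec TYPE('r) n (\<lambda>i. c i \<cdot>\<^sub>v u i) {..<d}) \<and>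
        (\<forall>c. finsum_vec TYPE('r) n (\<lambda>i. c i \<cdot>\<^sub>v u i) {..<d} = 0\<^sub>v n \<longrightarrow>
           (\<exists>s. s \<notin> P \<and> (\<forall>i < d. s * c i = 0)))))"

text \<open>
  \<open>Gr_points \<Lambda> d n \<rho> \<phi>\<close> is the set of \<open>R\<close>-points of \<open>Gr\<^sub>\<Lambda>(d, M)\<close>, where \<open>\<rho>\<close> is the module structure
  of \<open>M = k\<^sup>n\<close> and \<open>\<phi>\<close> the structure map of \<open>R\<close>.
\<close>

definition Gr_points ::
  "('k::field, 'l) module \<Rightarrow> nat \<Rightarrow> nat \<Rightarrow> ('l \<Rightarrow> 'k mat) \<Rightarrow> ('k \<Rightarrow> 'r::comm_ring_1) \<Rightarrow> 'r vec set set"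
  where
  "Gr_points \<Lambda> d n \<rho> \<phi> =
     {U. tensor_submodule \<Lambda> n \<phi> \<rho> U \<and> direct_summand n U \<and> has_rank n U d}"

text \<open>
  The map \<open>Gr\<^sub>\<Lambda>(d, M)(R) \<rightarrow> Gr\<^sub>\<Lambda>(d, M)(S)\<close> induced by \<open>\<psi> : R \<rightarrow> S\<close> sends \<open>U\<close> to \<open>U \<otimes>\<^sub>R S\<close>. Since \<open>U\<close> is a
  direct summand of \<open>R\<^sup>n\<close>, the latter embeds into \<open>S\<^sup>n\<close> as the \<open>S\<close>-span of the image of \<open>U\<close>.
\<close>

definition Gr_map :: "nat \<Rightarrow> ('r::comm_ring_1 \<Rightarrow> 's::comm_ring_1) \<Rightarrow> 'r vec set \<Rightarrow> 's vec set" where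
  "Gr_map n \<psi> U =
     LinearCombinations.module.span class_ring (module_vec TYPE('s) n) (map_vec \<psi> ` U)"


section \<open>Dual numbers\<close>

text \<open>\<open>Dual a b\<close> is the element \<open>a + b\<epsilon>\<close> of \<open>K[\<epsilon>]\<close>, where \<open>\<epsilon>\<^sup>2 = 0\<close>.\<close>

datatype 'a dual = Dual (std: 'a) (eps: 'a)

instantiation dual :: (comm_ring_1) comm_ring_1
begin

definition "0 = Dual 0 0"
definition "1 = Dual 1 0"
definition "x + y = Dual (std x + std y) (eps x + eps y)"
definition "x - y = Dual (std x - std y) (eps x - eps y)"
definition "- x = Dual (- std x) (- eps x)"
definition "x * y = Dual (std x * std y) (std x * eps y + eps x * std y)"

instance
  by standard
    (auto simp: zero_dual_def one_dual_def plus_dual_def minus_dual_def uminus_dual_def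
      times_dual_def algebra_simps)

end

text \<open>
  \<open>Dual2 a b c\<close> is the element \<open>a + b\<epsilon>\<^sub>1 + c\<epsilon>\<^sub>2\<close> of
  \<open>K[\<epsilon>\<^sub>1, \<epsilon>\<^sub>2]/(\<epsilon>\<^sub>1, \<epsilon>\<^sub>2)\<^sup>2\<close>, which is the fibre product \<open>K[\<epsilon>] \<times>\<^sub>K K[\<epsilon>]\<close>.
\<close>

datatype 'a dual2 = Dual2 (std2: 'a) (eps1: 'a) (eps2: 'a)

instantiation dual2 :: (comm_ring_1) comm_ring_1
begin

definition "0 = Dual2 0 0 0"
definition "1 = Dual2 1 0 0"
definition "x + y = Dual2 (std2 x + std2 y) (eps1 x + eps1 y) (eps2 x + eps2 y)"
definition "x - y = Dual2 (std2 x - std2 y) (eps1 x - eps1 y) (eps2 x - eps2 y)"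
definition "- x = Dual2 (- std2 x) (- eps1 x) (- eps2 x)"
definition "x * y = Dual2 (std2 x * std2 y)
  (std2 x * eps1 y + eps1 x * std2 y) (std2 x * eps2 y + eps2 x * std2 y)"

instance
  by standard
    (auto simp: zero_dual2_def one_dual2_def plus_dual2_def minus_dual2_def uminus_dual2_def
      times_dual2_def algebra_simps)

end

definition dual_const :: "'a::zero \<Rightarrow> 'a dual" where
  "dual_const a = Dual a 0"

definition dual2_const :: "'a::zero \<Rightarrow> 'a dual2" where
  "dual2_const a = Dual2 a 0 0"

definition dual_scale :: "'a::times \<Rightarrow> 'a dual \<Rightarrow> 'a dual" where
  "dual_scale c x = Dual (std x) (c * eps x)"

definition dual2_fst :: "'a dual2 \<Rightarrow> 'a dual" where
  "dual2_fst x = Dual (std2 x) (eps1 x)"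

definition dual2_snd :: "'a dual2 \<Rightarrow> 'a dual" where
  "dual2_snd x = Dual (std2 x) (eps2 x)"

definition dual2_sum :: "'a::plus dual2 \<Rightarrow> 'a dual" where
  "dual2_sum x = Dual (std2 x) (eps1 x + eps2 x)"


section \<open>The tangent space\<close>

text \<open>
  The fibre over \<open>U\<close> of \<open>X(K[\<epsilon>]) \<rightarrow> X(K)\<close>, for \<open>X = Gr\<^sub>\<Lambda>(d, M)\<close>, with its functorial \<open>K\<close>-vector
  space structure: \<open>c \<in> K\<close> acts through \<open>\<epsilon> \<mapsto> c\<epsilon>\<close>, zero is the image of \<open>U\<close> under \<open>K \<rightarrow> K[\<epsilon>]\<close>, and the
  addition is \<open>X(K[\<epsilon>]) \<times>\<^bsub>X(K)\<^esub> X(K[\<epsilon>]) = X(K[\<epsilon>] \<times>\<^sub>K K[\<epsilon>]) \<rightarrow> X(K[\<epsilon>])\<close>, the latter map being induced by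
  \<open>\<epsilon>\<^sub>1, \<epsilon>\<^sub>2 \<mapsto> \<epsilon>\<close>. Here \<open>\<iota>\<close> is the structure map \<open>k \<rightarrow> K\<close>. The fields \<open>mult\<close> and \<open>one\<close> of the record
  are irrelevant for modules.
\<close>

definition tangent_space ::
  "('k::field, 'l) module \<Rightarrow> nat \<Rightarrow> nat \<Rightarrow> ('l \<Rightarrow> 'k mat) \<Rightarrow> ('k \<Rightarrow> 'K::field) \<Rightarrow> 'K vec set
    \<Rightarrow> ('K, 'K dual vec set) module" where
  "tangent_space \<Lambda> d n \<rho> \<iota> U =
     \<lparr>carrier = {V \<in> Gr_points \<Lambda> d n \<rho> (dual_const \<circ> \<iota>). Gr_map n std V = U},
      mult = undefined, one = undefined,
      zero = Gr_map n dual_const U,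
      add = (\<lambda>V\<^sub>1 V\<^sub>2. Gr_map n dual2_sum
        (THE W. W \<in> Gr_points \<Lambda> d n \<rho> (dual2_const \<circ> \<iota>) \<and>
           Gr_map n dual2_fst W = V\<^sub>1 \<and> Gr_map n dual2_snd W = V\<^sub>2)),
      smult = (\<lambda>c V. Gr_map n (dual_scale c) V)\<rparr>"


section \<open>Homomorphisms into the quotient\<close>

text \<open>The map on \<open>V/U\<close> induced by a map \<open>f\<close> on \<open>V\<close> that preserves the submodule \<open>U\<close>.\<close>

definition quotient_map :: "('r, 'v) module \<Rightarrow> 'v set \<Rightarrow> ('v \<Rightarrow> 'v) \<Rightarrow> 'v set \<Rightarrow> 'v set" where
  "quotient_map V U f C = (\<Union>x \<in> C. U +>\<^bsub>V\<^esub> f x)"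

definition quotient_module :: "('r, 'v) module \<Rightarrow> 'v set \<Rightarrow> ('r, 'v set) module" where
  "quotient_module V U =
     \<lparr>carrier = a_rcosets\<^bsub>V\<^esub> U, mult = undefined, one = undefined,
      zero = U, add = (<+>\<^bsub>V\<^esub>), smult = (\<lambda>c. quotient_map V U (\<lambda>x. c \<odot>\<^bsub>V\<^esub> x))\<rparr>"

text \<open>
  Homomorphisms of \<open>\<Lambda> \<otimes>\<^sub>k R\<close>-modules from \<open>A\<close> to \<open>B\<close>, on which \<open>\<Lambda> \<otimes>\<^sub>k R\<close> acts by \<open>\<alpha>\<close> and \<open>\<beta>\<close>, as an \<open>R\<close>-module.
\<close>

definition tensor_hom ::
  "('k, 'l) module \<Rightarrow> ('r, 'a) module \<Rightarrow> (('l \<times> 'r) list \<Rightarrow> 'a \<Rightarrow> 'a)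
    \<Rightarrow> ('r, 'b) module \<Rightarrow> (('l \<times> 'r) list \<Rightarrow> 'b \<Rightarrow> 'b) \<Rightarrow> ('r, 'a \<Rightarrow> 'b) module" where
  "tensor_hom \<Lambda> A \<alpha> B \<beta> =
     \<lparr>carrier = {f \<in> carrier A \<rightarrow>\<^sub>E carrier B.
        (\<forall>x \<in> carrier A. \<forall>y \<in> carrier A. f (x \<oplus>\<^bsub>A\<^esub> y) = f x \<oplus>\<^bsub>B\<^esub> f y) \<and>
        (\<forall>t \<in> tensor_reps \<Lambda>. \<forall>x \<in> carrier A. f (\<alpha> t x) = \<beta> t (f x))},
      mult = undefined, one = undefined,
      zero = (\<lambda>x \<in> carrier A. \<zero>\<^bsub>B\<^esub>),
      add = (\<lambda>f g. \<lambda>x \<in> carrier A. f x \<oplus>\<^bsub>B\<^esub> g x),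
      smult = (\<lambda>c f. \<lambda>x \<in> carrier A. c \<odot>\<^bsub>B\<^esub> f x)\<rparr>"

text \<open>The \<open>K\<close>-vector space of \<open>\<Lambda> \<otimes>\<^sub>k K\<close>-homomorphisms \<open>U \<rightarrow> (M \<otimes>\<^sub>k K)/U\<close>.\<close>

definition hom_to_quotient ::
  "('k::field, 'l) module \<Rightarrow> nat \<Rightarrow> ('l \<Rightarrow> 'k mat) \<Rightarrow> ('k \<Rightarrow> 'K::field) \<Rightarrow> 'K vec set
    \<Rightarrow> ('K, 'K vec \<Rightarrow> 'K vec set) module" where
  "hom_to_quotient \<Lambda> n \<rho> \<iota> U =
     (let V = module_vec TYPE('K) n in
      tensor_hom \<Lambda>
        (V\<lparr>carrier := U\<rparr>) (tensor_act n \<iota> \<rho>)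
        (quotient_module V U) (\<lambda>t. quotient_map V U (tensor_act n \<iota> \<rho> t)))"

definition vector_space_iso :: "('K::field, 'v) module \<Rightarrow> ('K, 'w) module \<Rightarrow> bool" where
  "vector_space_iso V W \<longleftrightarrow>
     (\<exists>f. linear_map class_ring V W f \<and> bij_betw f (carrier V) (carrier W))"

end

theory Submission
  imports Defs
begin

text \<open>
  Every vector in \<open>K[\<epsilon>]\<^sup>n\<close> is uniquely \<open>x + \<epsilon>y\<close> with \<open>x, y\<close> in \<open>K\<^sup>n\<close>.
  A \<open>\<Lambda> \<otimes>\<^sub>k K\<close>-homomorphism \<open>\<theta> : U \<rightarrow> K\<^sup>n/U\<close> has a graph
  \<open>V\<^sub>\<theta> = {x + \<epsilon>y. x \<in> U, y \<in> \<theta>(x)}\<close>, and \<open>\<theta> \<mapsto> V\<^sub>\<theta>\<close> is the isomorphism from \<open>Hom(U, K\<^sup>n/U)\<close> to the tangent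
  space.

  Two observations carry the proof. First, a Nakayama argument: a submodule of \<open>V\<^sub>\<theta>\<close> that still
  surjects onto \<open>U\<close> modulo \<open>\<epsilon>\<close> contains \<open>\<epsilon>U\<close>, hence is all of \<open>V\<^sub>\<theta>\<close> (\<open>nakayama\<close>). This shows that
  lifts of a basis of \<open>U\<close> are a basis of \<open>V\<^sub>\<theta>\<close>, so that the rank is right. It also reduces
  every equality between such submodules to one inclusion, in particular the computation of images
  under \<open>Gr_map\<close> (\<open>Gr_map_eq_lift\<close>). Second, if \<open>V\<close> is a direct summand lying over \<open>U\<close>, then
  \<open>\<epsilon>y \<in> V\<close> holds exactly for \<open>y \<in> U\<close> (\<open>summand_eps_components\<close>): writing \<open>y = v + w\<close> along a
  decomposition \<open>V \<oplus> W\<close>, the vector \<open>\<epsilon>w = \<epsilon>y - \<epsilon>v\<close> lies in \<open>V \<inter> W\<close> and so vanishes,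
  which makes \<open>y\<close> the residue of \<open>v\<close>. Therefore
  \<open>\<theta>(x) = {y. x + \<epsilon>y \<in> V}\<close> is a coset of \<open>U\<close> for each \<open>x \<in> U\<close>, and \<open>V\<close> is the graph of \<open>\<theta>\<close>
  (\<open>lift_surj_on_points\<close>).

  The addition of tangent vectors goes through \<open>K[\<epsilon>\<^sub>1, \<epsilon>\<^sub>2]/(\<epsilon>\<^sub>1, \<epsilon>\<^sub>2)\<^sup>2\<close>, where the same analysis is needed
  for pairs of homomorphisms. Both rings are square-zero extensions \<open>K \<oplus> K\<^sup>J\<close> with finite \<open>J\<close>, and
  everything is proved at this level: points over \<open>U\<close> correspond to families of homomorphisms indexed by \<open>J\<close>.
  The point over \<open>V\<^sub>\<theta>\<close> and \<open>V\<^sub>\<eta>\<close> is the common graph of \<open>\<theta>\<close> and \<open>\<eta>\<close>, which \<open>\<epsilon>\<^sub>1, \<epsilon>\<^sub>2 \<mapsto> \<epsilon>\<close> sends to the graph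
  of \<open>\<theta> + \<eta>\<close>. The vector space axioms are checked on the side of homomorphisms and transported
  along the bijection.
\<close>

section \<open>Transport of vector space structures\<close>

text \<open>
  A priori \<open>V\<close> is a set with operations; the laws of a vector space come from \<open>W\<close> through the
  bijection \<open>g\<close>. In the application \<open>V\<close> is the tangent space, whose addition is hard to handle directly.
\<close>

lemma vector_space_iso_transport:
  fixes V :: "('K::field, 'v) module" and W :: "('K, 'w) module"
  assumes W: "Module.module class_ring W"
    and bij: "bij_betw g (carrier W) (carrier V)"
    and zero: "g \<zero>\<^bsub>W\<^esub> = \<zero>\<^bsub>V\<^esub>"
    and add: "\<And>x y. \<lbrakk>x \<in> carrier W; y \<in> carrier W\<rbrakk> \<Longrightarrow> g (x \<oplus>\<^bsub>W\<^esub> y) = g x \<oplus>\<^bsub>V\<^esub> g y"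
    and smult: "\<And>c x. x \<in> carrier W \<Longrightarrow> g (c \<odot>\<^bsub>W\<^esub> x) = c \<odot>\<^bsub>V\<^esub> g x"
  shows "vector_space_iso V W"
proof -
  interpret W: Module.module class_ring W by (rule W)
  have V_eq: "carrier V = g ` carrier W"
    using bij by (auto simp: bij_betw_def)
  have smW: "c \<odot>\<^bsub>W\<^esub> x \<in> carrier W" if "x \<in> carrier W" for c x
    using W.smult_closed that by simp
  have "abelian_group V"
  proof (rule abelian_groupI)
    show "\<exists>y\<in>carrier V. y \<oplus>\<^bsub>V\<^esub> x = \<zero>\<^bsub>V\<^esub>" if x: "x \<in> carrier V" for x
    proof -
      obtain w where w: "w \<in> carrier W" "x = g w" using x V_eq by auto
      have "g (\<ominus>\<^bsub>W\<^esub> w) \<oplus>\<^bsub>V\<^esub> x = \<zero>\<^bsub>V\<^esub>"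
        using w zero by (simp add: add[symmetric] W.l_neg)
      then show ?thesis using w V_eq by auto
    qed
  qed (auto simp: V_eq add[symmetric] zero[symmetric] W.M.add.m_ac)
  then have V: "Module.module class_ring V"
  proof (rule moduleI[OF module.axioms(1)[OF W]])
    fix a b :: 'K and x y
    show "a \<odot>\<^bsub>V\<^esub> x \<in> carrier V" if "x \<in> carrier V"
      using that smW by (auto simp: V_eq smult[symmetric])
    show "(a \<oplus>\<^bsub>class_ring\<^esub> b) \<odot>\<^bsub>V\<^esub> x = (a \<odot>\<^bsub>V\<^esub> x) \<oplus>\<^bsub>V\<^esub> (b \<odot>\<^bsub>V\<^esub> x)" if "x \<in> carrier V"
      using that smW W.smult_l_distr[of a b] by (auto simp: V_eq smult[symmetric] add[symmetric])
    show "a \<odot>\<^bsub>V\<^esub> (x \<oplus>\<^bsub>V\<^esub> y) = (a \<odot>\<^bsub>V\<^esub> x) \<oplus>\<^bsub>V\<^esub> (a \<odot>\<^bsub>V\<^esub> y)" if "x \<in> carrier V" "y \<in> carrier V"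
      using that smW W.smult_r_distr[of a] by (auto simp: V_eq smult[symmetric] add[symmetric])
    show "(a \<otimes>\<^bsub>class_ring\<^esub> b) \<odot>\<^bsub>V\<^esub> x = a \<odot>\<^bsub>V\<^esub> (b \<odot>\<^bsub>V\<^esub> x)" if "x \<in> carrier V"
      using that smW W.smult_assoc1[of a b] by (auto simp: V_eq smult[symmetric])
    show "\<one>\<^bsub>class_ring\<^esub> \<odot>\<^bsub>V\<^esub> x = x" if "x \<in> carrier V"
      using that W.smult_one by (auto simp: V_eq smult[symmetric])
  qed
  define f where "f = inv_into (carrier W) g"
  have f: "bij_betw f (carrier V) (carrier W)"
    unfolding f_def by (rule bij_betw_inv_into[OF bij])
  have fg: "f (g w) = w" if "w \<in> carrier W" for w
    using that bij unfolding f_def bij_betw_def by simp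
  have hom: "f \<in> LinearCombinations.module_hom class_ring V W"
    unfolding LinearCombinations.module_hom_def
    using smW by (auto simp: V_eq fg add[symmetric] smult[symmetric])
  have "mod_hom class_ring V W f"
    using V W hom by (simp add: mod_hom_def mod_hom_axioms_def)
  then have "linear_map class_ring V W f"
    using V W class_field by (simp add: linear_map_def vectorspace_def)
  then show ?thesis
    unfolding vector_space_iso_def using f by blast
qed


section \<open>Quotient modules and modules of homomorphisms\<close>

text \<open>
  The union over a coset that defines the induced map is again a single coset, so computations in
  the quotient can be done on representatives.
\<close>

lemma quotient_map_coset:
  fixes M :: "('r, 'v) module"
  assumes M: "Module.module R M"
    and U: "LinearCombinations.submodule R U M"
    and closed: "\<And>x. x \<in> carrier M \<Longrightarrow> f x \<in> carrier M"
    and add: "\<And>x y. \<lbrakk>x \<in> carrier M; y \<in> carrier M\<rbrakk> \<Longrightarrow> f (x \<oplus>\<^bsub>M\<^esub> y) = f x \<oplus>\<^bsub>M\<^esub> f y"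
    and stable: "\<And>x. x \<in> U \<Longrightarrow> f x \<in> U"
    and x: "x \<in> carrier M"
  shows "quotient_map M U f (U +>\<^bsub>M\<^esub> x) = U +>\<^bsub>M\<^esub> f x"
proof -
  interpret Module.module R M by (rule M)
  interpret U: LinearCombinations.submodule R U M by (rule U)
  have Uc: "u \<in> carrier M" if "u \<in> U" for u using that U.subset by auto
  show ?thesis
    unfolding quotient_map_def a_r_coset_def'
  proof safe
    fix h h' assume h: "h \<in> U" "h' \<in> U"
    have "h' \<oplus>\<^bsub>M\<^esub> f (h \<oplus>\<^bsub>M\<^esub> x) = (h' \<oplus>\<^bsub>M\<^esub> f h) \<oplus>\<^bsub>M\<^esub> f x"
      using h x closed Uc by (simp add: add M.add.m_assoc)
    then show "h' \<oplus>\<^bsub>M\<^esub> f (h \<oplus>\<^bsub>M\<^esub> x) \<in> (\<Union>h\<in>U. {h \<oplus>\<^bsub>M\<^esub> f x})"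
      using h stable U.m_closed by auto
  next
    fix h assume h: "h \<in> U"
    have "x = \<zero>\<^bsub>M\<^esub> \<oplus>\<^bsub>M\<^esub> x" using x by simp
    then show "h \<oplus>\<^bsub>M\<^esub> f x \<in> (\<Union>x\<in>\<Union>h\<in>U. {h \<oplus>\<^bsub>M\<^esub> x}. \<Union>h\<in>U. {h \<oplus>\<^bsub>M\<^esub> f x})"
      using h U.zero_closed by (metis (no_types, lifting) UN_iff singletonI)
  qed
qed

lemma (in Module.module) submodule_abelian_subgroup:
  assumes U: "LinearCombinations.submodule R U M"
  shows "abelian_subgroup U M"
proof -
  interpret U: LinearCombinations.submodule R U M by (rule U)
  have "\<ominus>\<^bsub>M\<^esub> u \<in> U" if "u \<in> U" for u
  proof -
    have u: "u \<in> carrier M" using that U.subset by blast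
    have "(\<ominus> \<one>) \<odot>\<^bsub>M\<^esub> u \<in> U" by (rule U.smult_closed) (use that in simp_all)
    also have "(\<ominus> \<one>) \<odot>\<^bsub>M\<^esub> u = \<ominus>\<^bsub>M\<^esub> u" using smult_l_minus[of "\<one>" u] u by simp
    finally show ?thesis .
  qed
  then have "additive_subgroup U M"
    using U.subset U.m_closed U.zero_closed
    by (intro additive_subgroup.intro subgroup.intro) (auto simp: a_inv_def)
  then show ?thesis
    by (rule abelian_subgroupI3) (rule M.abelian_group_axioms)
qed

lemma quotient_module_add_coset:
  fixes M :: "('r, 'v) module"
  assumes M: "Module.module R M"
    and U: "LinearCombinations.submodule R U M" and xy: "x \<in> carrier M" "y \<in> carrier M"
  shows "(U +>\<^bsub>M\<^esub> x) \<oplus>\<^bsub>quotient_module M U\<^esub> (U +>\<^bsub>M\<^esub> y) = U +>\<^bsub>M\<^esub> (x \<oplus>\<^bsub>M\<^esub> y)"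
proof -
  interpret S: abelian_subgroup U M by (rule module.submodule_abelian_subgroup[OF M U])
  show ?thesis using xy by (simp add: quotient_module_def S.a_rcos_sum)
qed

lemma quotient_module_is_module:
  fixes M :: "('r, 'v) module"
  assumes M: "Module.module R M"
    and U: "LinearCombinations.submodule R U M"
  shows "Module.module R (quotient_module M U)"
proof -
  interpret Module.module R M by (rule M)
  interpret U: LinearCombinations.submodule R U M by (rule U)
  interpret S: abelian_subgroup U M by (rule submodule_abelian_subgroup[OF U])
  let ?Q = "quotient_module M U"
  have car: "carrier ?Q = {U +>\<^bsub>M\<^esub> x | x. x \<in> carrier M}"
    by (auto simp: quotient_module_def A_RCOSETS_defs a_r_coset_defs)
  have add: "(U +>\<^bsub>M\<^esub> x) \<oplus>\<^bsub>?Q\<^esub> (U +>\<^bsub>M\<^esub> y) = U +>\<^bsub>M\<^esub> (x \<oplus>\<^bsub>M\<^esub> y)"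
    if "x \<in> carrier M" "y \<in> carrier M" for x y
    using quotient_module_add_coset[OF M U that] .
  have zero: "\<zero>\<^bsub>?Q\<^esub> = U +>\<^bsub>M\<^esub> \<zero>\<^bsub>M\<^esub>"
    using U.subset by (simp add: quotient_module_def)
  have smult: "c \<odot>\<^bsub>?Q\<^esub> (U +>\<^bsub>M\<^esub> x) = U +>\<^bsub>M\<^esub> (c \<odot>\<^bsub>M\<^esub> x)" if "c \<in> carrier R" "x \<in> carrier M" for c x
    unfolding quotient_module_def
    using that by (simp add: quotient_map_coset[OF M U] smult_r_distr)
  show ?thesis
  proof (rule moduleI[OF R.is_cring])
    show "abelian_group ?Q"
    proof (rule abelian_groupI)
      show "\<exists>y\<in>carrier ?Q. y \<oplus>\<^bsub>?Q\<^esub> C = \<zero>\<^bsub>?Q\<^esub>" if C: "C \<in> carrier ?Q" for C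
      proof -
        obtain x where "x \<in> carrier M" "C = U +>\<^bsub>M\<^esub> x" using C car by auto
        then show ?thesis
          by (intro bexI[of _ "U +>\<^bsub>M\<^esub> (\<ominus>\<^bsub>M\<^esub> x)"]) (auto simp: add zero M.l_neg car)
      qed
    next
      fix C D assume "C \<in> carrier ?Q" "D \<in> carrier ?Q"
      then obtain x y where "x \<in> carrier M" "C = U +>\<^bsub>M\<^esub> x" "y \<in> carrier M" "D = U +>\<^bsub>M\<^esub> y"
        unfolding car by blast
      then show "C \<oplus>\<^bsub>?Q\<^esub> D \<in> carrier ?Q" and "C \<oplus>\<^bsub>?Q\<^esub> D = D \<oplus>\<^bsub>?Q\<^esub> C"
        by (auto simp: car add M.add.m_comm)
    next
      show "\<zero>\<^bsub>?Q\<^esub> \<in> carrier ?Q" by (auto simp: car zero)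
    qed (auto simp: car add zero M.add.m_assoc)
  next
    fix a C assume "a \<in> carrier R" "C \<in> carrier ?Q"
    then show "a \<odot>\<^bsub>?Q\<^esub> C \<in> carrier ?Q" by (auto simp: car smult; blast)
  qed (auto simp: car add smult smult_l_distr smult_r_distr smult_assoc1)
qed

text \<open>
  All module axioms hold pointwise in \<open>B\<close>. The work is in closedness, which needs \<open>\<Lambda> \<otimes>\<^sub>k R\<close> to act
  on \<open>B\<close> additively and \<open>R\<close>-linearly.
\<close>

lemma tensor_hom_is_module:
  assumes B: "Module.module R B"
    and addA: "\<And>x y. \<lbrakk>x \<in> carrier A; y \<in> carrier A\<rbrakk> \<Longrightarrow> x \<oplus>\<^bsub>A\<^esub> y \<in> carrier A"
    and \<alpha>: "\<And>t x. \<lbrakk>t \<in> tensor_reps \<Lambda>; x \<in> carrier A\<rbrakk> \<Longrightarrow> \<alpha> t x \<in> carrier A"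
    and \<beta>_add: "\<And>t x y. \<lbrakk>t \<in> tensor_reps \<Lambda>; x \<in> carrier B; y \<in> carrier B\<rbrakk>
      \<Longrightarrow> \<beta> t (x \<oplus>\<^bsub>B\<^esub> y) = \<beta> t x \<oplus>\<^bsub>B\<^esub> \<beta> t y"
    and \<beta>_smult: "\<And>t c x. \<lbrakk>t \<in> tensor_reps \<Lambda>; c \<in> carrier R; x \<in> carrier B\<rbrakk>
      \<Longrightarrow> \<beta> t (c \<odot>\<^bsub>B\<^esub> x) = c \<odot>\<^bsub>B\<^esub> \<beta> t x"
    and \<beta>: "\<And>t x. \<lbrakk>t \<in> tensor_reps \<Lambda>; x \<in> carrier B\<rbrakk> \<Longrightarrow> \<beta> t x \<in> carrier B"
  shows "Module.module R (tensor_hom \<Lambda> A \<alpha> B \<beta>)" (is "Module.module R ?H")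
proof -
  interpret B: Module.module R B by (rule B)
  have \<beta>_zero: "\<beta> t \<zero>\<^bsub>B\<^esub> = \<zero>\<^bsub>B\<^esub>" if "t \<in> tensor_reps \<Lambda>" for t
    using \<beta>_smult[OF that B.R.zero_closed B.M.zero_closed] \<beta>[OF that B.M.zero_closed] by simp
  have H: "f x \<in> carrier B" if "f \<in> carrier ?H" "x \<in> carrier A" for f x
    using that by (auto simp: tensor_hom_def)
  have H_eqI: "f = g" if "f \<in> carrier ?H" "g \<in> carrier ?H" "\<And>x. x \<in> carrier A \<Longrightarrow> f x = g x" for f g
    using that by (intro PiE_ext[of f "carrier A" "\<lambda>_. carrier B" g]) (simp_all add: tensor_hom_def)
  have zero: "\<zero>\<^bsub>?H\<^esub> \<in> carrier ?H"
    using \<beta>_zero \<alpha> addA by (auto simp: tensor_hom_def)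
  have add: "f \<oplus>\<^bsub>?H\<^esub> g \<in> carrier ?H" if "f \<in> carrier ?H" "g \<in> carrier ?H" for f g
  proof -
    have "f x \<in> carrier B" "g x \<in> carrier B" if "x \<in> carrier A" for x
      using H that \<open>f \<in> _\<close> \<open>g \<in> _\<close> by auto
    then show ?thesis using that \<alpha> addA
      by (auto simp: tensor_hom_def \<beta>_add B.M.add.m_ac)
  qed
  have smult: "c \<odot>\<^bsub>?H\<^esub> f \<in> carrier ?H" if c: "c \<in> carrier R" and f: "f \<in> carrier ?H" for c f
  proof -
    have "f x \<in> carrier B" if "x \<in> carrier A" for x
      using H that f by auto
    then show ?thesis using c f \<alpha> addA
      by (auto simp: tensor_hom_def \<beta>_smult B.smult_r_distr)
  qed
  have zero_ap: "\<zero>\<^bsub>?H\<^esub> x = \<zero>\<^bsub>B\<^esub>" if "x \<in> carrier A" for x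
    using that by (simp add: tensor_hom_def)
  have add_ap: "(f \<oplus>\<^bsub>?H\<^esub> g) x = f x \<oplus>\<^bsub>B\<^esub> g x" if "x \<in> carrier A" for f g x
    using that by (simp add: tensor_hom_def)
  have smult_ap: "(c \<odot>\<^bsub>?H\<^esub> f) x = c \<odot>\<^bsub>B\<^esub> f x" if "x \<in> carrier A" for c f x
    using that by (simp add: tensor_hom_def)
  note ap = zero_ap add_ap smult_ap
  show ?thesis
  proof (rule moduleI[OF B.R.is_cring])
    show "abelian_group ?H"
    proof (rule abelian_groupI)
      fix f assume f: "f \<in> carrier ?H"
      have "(\<ominus>\<^bsub>R\<^esub> \<one>\<^bsub>R\<^esub>) \<odot>\<^bsub>?H\<^esub> f \<oplus>\<^bsub>?H\<^esub> f = \<zero>\<^bsub>?H\<^esub>"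
        by (rule H_eqI) (auto simp: add smult zero f ap H B.smult_l_minus B.M.l_neg)
      then show "\<exists>y\<in>carrier ?H. y \<oplus>\<^bsub>?H\<^esub> f = \<zero>\<^bsub>?H\<^esub>" using smult[OF _ f] by blast
    qed (auto intro!: H_eqI simp: add zero ap H B.M.add.m_ac)
  qed (auto intro!: H_eqI simp: add smult zero ap H B.smult_l_distr B.smult_r_distr B.smult_assoc1)
qed


section \<open>Submodules of free modules and their cosets\<close>

lemma module_vec_module: "Module.module class_ring (module_vec TYPE('r::comm_ring_1) n)"
proof -
  interpret vec_module "TYPE('r)" n .
  show ?thesis by (fact module_axioms)
qed

abbreviation vec_submodule :: "nat \<Rightarrow> 'r::comm_ring_1 vec set \<Rightarrow> bool" where
  "vec_submodule n U \<equiv> LinearCombinations.submodule class_ring U (module_vec TYPE('r) n)"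

lemma vec_submodule_iff:
  "vec_submodule n (U :: 'r::comm_ring_1 vec set) \<longleftrightarrow>
     U \<subseteq> carrier_vec n \<and> 0\<^sub>v n \<in> U \<and> (\<forall>x\<in>U. \<forall>y\<in>U. x + y \<in> U) \<and> (\<forall>c. \<forall>x\<in>U. c \<cdot>\<^sub>v x \<in> U)"
  unfolding LinearCombinations.submodule_def using module_vec_module[where 'r='r and n=n]
  by (auto simp: module_vec_simps)

lemma vec_submoduleD:
  assumes "vec_submodule n (U :: 'r::comm_ring_1 vec set)"
  shows "x \<in> U \<Longrightarrow> x \<in> carrier_vec n" "0\<^sub>v n \<in> U" "\<lbrakk>x \<in> U; y \<in> U\<rbrakk> \<Longrightarrow> x + y \<in> U"
    "x \<in> U \<Longrightarrow> c \<cdot>\<^sub>v x \<in> U" "\<lbrakk>x \<in> U; y \<in> U\<rbrakk> \<Longrightarrow> x - y \<in> U"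
proof -
  show *: "x \<in> U \<Longrightarrow> x \<in> carrier_vec n" "0\<^sub>v n \<in> U" "\<lbrakk>x \<in> U; y \<in> U\<rbrakk> \<Longrightarrow> x + y \<in> U"
    "x \<in> U \<Longrightarrow> c \<cdot>\<^sub>v x \<in> U" for x y c
    using assms by (auto simp: vec_submodule_iff)
  show "x - y \<in> U" if "x \<in> U" "y \<in> U"
  proof -
    have "x - y = x + (- 1) \<cdot>\<^sub>v y" using *(1)[OF that(1)] *(1)[OF that(2)] by auto
    then show ?thesis using * that by simp
  qed
qed

lemma coset_vec: "U +>\<^bsub>module_vec TYPE('r::comm_ring_1) n\<^esub> y = (\<lambda>u. u + y) ` (U :: 'r vec set)"
  by (auto simp: a_r_coset_def' module_vec_simps)

lemma self_in_coset:
  assumes "vec_submodule n U" "y \<in> carrier_vec n"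
  shows "y \<in> (\<lambda>u. u + y) ` U"
  using vec_submoduleD(2)[OF assms(1)] assms(2) by (intro image_eqI[of _ _ "0\<^sub>v n"]) auto

lemma coset_closed:
  assumes "vec_submodule n U" "y \<in> carrier_vec n" "z \<in> (\<lambda>u. u + y) ` U"
  shows "z \<in> carrier_vec n"
  using assms(2,3) vec_submoduleD(1)[OF assms(1)] by auto

lemma coset_diff:
  assumes U: "vec_submodule n U" and y: "y \<in> carrier_vec n"
    and z: "z \<in> (\<lambda>u. u + y) ` U" "z' \<in> (\<lambda>u. u + y) ` U"
  shows "z - z' \<in> U"
proof -
  obtain u u' where u: "u \<in> U" "u' \<in> U" "z = u + y" "z' = u' + y" using z by auto
  have "z - z' = u - u'"
    using u y vec_submoduleD(1)[OF U u(1)] vec_submoduleD(1)[OF U u(2)] by auto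
  then show ?thesis using u vec_submoduleD(5)[OF U] by simp
qed

lemma coset_eq:
  assumes U: "vec_submodule n U" and y: "y \<in> carrier_vec n" and z: "z \<in> (\<lambda>u. u + y) ` U"
  shows "(\<lambda>u. u + y) ` U = (\<lambda>u. u + z) ` U"
proof -
  obtain w where w: "w \<in> U" "z = w + y" using z by auto
  note c = vec_submoduleD(1)[OF U]
  have 1: "u + y = (u - w) + z" if "u \<in> U" for u using c[OF that] c[OF w(1)] w y by auto
  have 2: "u + z = (u + w) + y" if "u \<in> U" for u using c[OF that] c[OF w(1)] w y by auto
  show ?thesis
    using vec_submoduleD(3,5)[OF U _ w(1)] 1 2 unfolding image_def by blast
qed

lemma coset_add:
  assumes U: "vec_submodule n U" and y: "y \<in> carrier_vec n" and z: "z \<in> (\<lambda>u. u + y) ` U"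
    and v: "v \<in> U"
  shows "z + v \<in> (\<lambda>u. u + y) ` U"
proof -
  obtain w where w: "w \<in> U" "z = w + y" using z by auto
  note c = vec_submoduleD(1)[OF U]
  have "z + v = (w + v) + y" using c[OF v] c[OF w(1)] w y by auto
  then show ?thesis using vec_submoduleD(3)[OF U w(1) v] by auto
qed

lemma coset_zero:
  assumes "vec_submodule n U"
  shows "(\<lambda>u. u + 0\<^sub>v n) ` U = U"
  using vec_submoduleD(1)[OF assms] by force


section \<open>Module structures given by matrices\<close>

lemma mat_vec_smult:
  fixes A :: "'r::comm_ring_1 mat"
  assumes "A \<in> carrier_mat m n" "v \<in> carrier_vec n"
  shows "A *\<^sub>v (c \<cdot>\<^sub>v v) = c \<cdot>\<^sub>v (A *\<^sub>v v)"
  using assms by (intro eq_vecI) (auto simp: scalar_prod_def sum_distrib_left algebra_simps)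

text \<open>
  That the unit of \<open>\<Lambda>\<close> acts as the identity makes a scalar \<open>c\<close> act in the same way as the element
  \<open>1 \<otimes> c\<close> of \<open>\<Lambda> \<otimes>\<^sub>k R\<close>. Hence \<open>\<Lambda> \<otimes>\<^sub>k R\<close>-stable subsets are \<open>R\<close>-submodules, and homomorphisms are \<open>R\<close>-linear.
\<close>

locale module_structure =
  fixes \<Lambda> :: "('k::field, 'l) module" and n :: nat and M :: "'l \<Rightarrow> 'k mat"
  assumes one_closed: "\<one>\<^bsub>\<Lambda>\<^esub> \<in> carrier \<Lambda>"
    and M_one: "M \<one>\<^bsub>\<Lambda>\<^esub> = 1\<^sub>m n"
    and M_closed: "l \<in> carrier \<Lambda> \<Longrightarrow> M l \<in> carrier_mat n n"

lemma module_structureI: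
  assumes "finitely_generated_algebra \<Lambda>" "M \<in> Mod_points \<Lambda> n"
  shows "module_structure \<Lambda> n M"
proof -
  interpret assoc_algebra class_ring \<Lambda>
    using assms(1) by (simp add: finitely_generated_algebra_def)
  show ?thesis
    using assms(2)
    by unfold_locales (auto simp: Mod_points_def Ring.ring_hom_def ring_mat_simps)
qed

context module_structure
begin

lemma action_closed [simp]:
  "l \<in> carrier \<Lambda> \<Longrightarrow> map_mat \<phi> (M l) *\<^sub>v v \<in> carrier_vec n"
  using M_closed[of l] by (auto intro!: carrier_vecI)

lemma action_carrier_mat: "l \<in> carrier \<Lambda> \<Longrightarrow> map_mat \<phi> (M l) \<in> carrier_mat n n"
  using M_closed by auto

lemma action_one:
  assumes "\<phi> 0 = (0 :: 'r::comm_ring_1)" "\<phi> 1 = 1" "v \<in> carrier_vec n"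
  shows "map_mat \<phi> (M \<one>\<^bsub>\<Lambda>\<^esub>) *\<^sub>v v = v"
proof -
  have "map_mat \<phi> (1\<^sub>m n) = 1\<^sub>m n" using assms by (intro eq_matI) auto
  then show ?thesis using assms M_one by simp
qed

lemma tensor_act_closed:
  assumes "t \<in> tensor_reps \<Lambda>"
  shows "tensor_act n \<phi> M t v \<in> carrier_vec n"
  using assms by (induction t) auto

lemma tensor_act_add:
  fixes \<phi> :: "'k \<Rightarrow> 'r::comm_ring_1"
  assumes "t \<in> tensor_reps \<Lambda>" "v \<in> carrier_vec n" "w \<in> carrier_vec n"
  shows "tensor_act n \<phi> M t (v + w) = tensor_act n \<phi> M t v + tensor_act n \<phi> M t w"
  using assms(1)
proof (induction t)
  case (Cons p t)
  let ?A = "map_mat \<phi> (M (fst p))"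
  have p: "fst p \<in> carrier \<Lambda>" and t: "t \<in> tensor_reps \<Lambda>" using Cons by auto
  have A: "?A \<in> carrier_mat n n" using action_carrier_mat[OF p] .
  have *: "?A *\<^sub>v v \<in> carrier_vec n" "?A *\<^sub>v w \<in> carrier_vec n"
    "tensor_act n \<phi> M t v \<in> carrier_vec n" "tensor_act n \<phi> M t w \<in> carrier_vec n"
    using p t tensor_act_closed by auto
  show ?case
    using Cons.IH * assms(2,3) mult_add_distrib_mat_vec[OF A assms(2,3)]
    by (auto simp: smult_add_distrib_vec[of _ n] algebra_simps intro!: eq_vecI)
qed auto

lemma tensor_act_smult:
  fixes \<phi> :: "'k \<Rightarrow> 'r::comm_ring_1"
  assumes "t \<in> tensor_reps \<Lambda>" "v \<in> carrier_vec n"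
  shows "tensor_act n \<phi> M t (c \<cdot>\<^sub>v v) = c \<cdot>\<^sub>v tensor_act n \<phi> M t v"
  using assms(1)
proof (induction t)
  case (Cons p t)
  let ?A = "map_mat \<phi> (M (fst p))"
  have p: "fst p \<in> carrier \<Lambda>" and t: "t \<in> tensor_reps \<Lambda>" using Cons by auto
  have A: "?A \<in> carrier_mat n n" using action_carrier_mat[OF p] .
  have *: "?A *\<^sub>v v \<in> carrier_vec n" "tensor_act n \<phi> M t v \<in> carrier_vec n"
    using p t tensor_act_closed by auto
  show ?case
    using Cons.IH *
    by (simp add: mat_vec_smult[OF A assms(2)] smult_add_distrib_vec[of _ n] smult_smult_assoc
        mult.commute)
qed auto

lemma tensor_act_mem:
  fixes \<phi> :: "'k \<Rightarrow> 'r::comm_ring_1"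
  assumes "vec_submodule n U"
    and "\<And>l x. \<lbrakk>l \<in> carrier \<Lambda>; x \<in> U\<rbrakk> \<Longrightarrow> map_mat \<phi> (M l) *\<^sub>v x \<in> U"
    and "t \<in> tensor_reps \<Lambda>" "x \<in> U"
  shows "tensor_act n \<phi> M t x \<in> U"
  using assms(3)
proof (induction t)
  case (Cons p t)
  then have "fst p \<in> carrier \<Lambda>" by auto
  with Cons show ?case using vec_submoduleD(3,4)[OF assms(1)] assms(2,4) by auto
qed (use vec_submoduleD(2)[OF assms(1)] in auto)

lemma tensor_act_pure:
  assumes "l \<in> carrier \<Lambda>"
  shows "tensor_act n \<phi> M [(l, 1)] v = map_mat \<phi> (M l) *\<^sub>v v"
  using action_closed[OF assms, of \<phi> v] by auto

lemma tensor_act_scalar: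
  assumes "\<phi> 0 = (0 :: 'r::comm_ring_1)" "\<phi> 1 = 1" "v \<in> carrier_vec n"
  shows "tensor_act n \<phi> M [(\<one>\<^bsub>\<Lambda>\<^esub>, c)] v = c \<cdot>\<^sub>v v"
  using action_one[OF assms] assms(3) by auto

text \<open>
  Since \<open>\<Lambda> \<otimes>\<^sub>k R\<close> is generated additively by the pure tensors, it is enough to test stability on the
  elements \<open>1 \<otimes> c\<close> and \<open>l \<otimes> 1\<close>.
\<close>

lemma tensor_submodule_iff:
  assumes \<phi>: "\<phi> 0 = (0 :: 'r::comm_ring_1)" "\<phi> 1 = 1"
  shows "tensor_submodule \<Lambda> n \<phi> M U \<longleftrightarrow>
    vec_submodule n U \<and> (\<forall>l\<in>carrier \<Lambda>. \<forall>x\<in>U. map_mat \<phi> (M l) *\<^sub>v x \<in> U)"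
proof
  assume *: "tensor_submodule \<Lambda> n \<phi> M U"
  then have U: "U \<subseteq> carrier_vec n" by (simp add: tensor_submodule_def)
  have t: "tensor_act n \<phi> M [(l, c)] x \<in> U" if "l \<in> carrier \<Lambda>" "x \<in> U" for l c x
    using * that by (simp add: tensor_submodule_def del: tensor_act.simps)
  have "c \<cdot>\<^sub>v x \<in> U" if "x \<in> U" for c x
    using t[OF one_closed that, of c] tensor_act_scalar[OF \<phi>, of x c] that U by auto
  moreover have "map_mat \<phi> (M l) *\<^sub>v x \<in> U" if "l \<in> carrier \<Lambda>" "x \<in> U" for l x
    using t[OF that, of 1] tensor_act_pure[OF that(1), of \<phi> x] by simp
  ultimately show "vec_submodule n U \<and> (\<forall>l\<in>carrier \<Lambda>. \<forall>x\<in>U. map_mat \<phi> (M l) *\<^sub>v x \<in> U)"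
    using * by (auto simp: vec_submodule_iff tensor_submodule_def)
next
  assume *: "vec_submodule n U \<and> (\<forall>l\<in>carrier \<Lambda>. \<forall>x\<in>U. map_mat \<phi> (M l) *\<^sub>v x \<in> U)"
  then show "tensor_submodule \<Lambda> n \<phi> M U"
    unfolding tensor_submodule_def using tensor_act_mem[of U \<phi>]
    by (auto simp: vec_submodule_iff)
qed

lemma quotient_module_vec_carrier:
  "carrier (quotient_module (module_vec TYPE('r::comm_ring_1) n) U) =
     {(\<lambda>u. u + y) ` U | y. y \<in> carrier_vec n}"
  by (auto simp: quotient_module_def A_RCOSETS_defs a_r_coset_defs module_vec_simps)

context
  fixes \<phi> :: "'k \<Rightarrow> 'r::comm_ring_1" and U :: "'r vec set"
  assumes \<phi>: "\<phi> 0 = 0" "\<phi> 1 = 1"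
    and tsub: "tensor_submodule \<Lambda> n \<phi> M U"
begin

private lemma U: "vec_submodule n U"
  using tensor_submodule_iff[OF \<phi>] tsub by blast

lemma quotient_map_tensor_act:
  assumes "t \<in> tensor_reps \<Lambda>" "y \<in> carrier_vec n"
  shows "quotient_map (module_vec TYPE('r) n) U (tensor_act n \<phi> M t) ((\<lambda>u. u + y) ` U)
    = (\<lambda>u. u + tensor_act n \<phi> M t y) ` U"
proof -
  have "tensor_act n \<phi> M t x \<in> U" if "x \<in> U" for x
    using tsub assms(1) that by (auto simp: tensor_submodule_def)
  then show ?thesis
    using quotient_map_coset[OF module_vec_module U, of "tensor_act n \<phi> M t" y] assms
    by (simp add: module_vec_simps tensor_act_closed tensor_act_add coset_vec)
qed

lemma quotient_map_smult_vec:
  assumes "y \<in> carrier_vec n"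
  shows "quotient_map (module_vec TYPE('r) n) U (\<lambda>x. c \<cdot>\<^sub>v x) ((\<lambda>u. u + y) ` U)
    = (\<lambda>u. u + c \<cdot>\<^sub>v y) ` U"
  using quotient_map_coset[OF module_vec_module U, of "\<lambda>x. c \<cdot>\<^sub>v x" y] assms vec_submoduleD(4)[OF U]
  by (simp add: module_vec_simps coset_vec smult_add_distrib_vec[of _ n])

lemma set_add_coset:
  assumes "x \<in> carrier_vec n" "y \<in> carrier_vec n"
  shows "(\<lambda>u. u + x) ` U <+>\<^bsub>module_vec TYPE('r) n\<^esub> (\<lambda>u. u + y) ` U = (\<lambda>u. u + (x + y)) ` U"
  using quotient_module_add_coset[OF module_vec_module U, of x y] assms
  by (simp add: quotient_module_def coset_vec module_vec_simps)

lemma quotient_vec_module: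
  "Module.module class_ring (quotient_module (module_vec TYPE('r) n) U)"
  by (rule quotient_module_is_module[OF module_vec_module U])
end

lemma hom_to_quotient_is_module:
  fixes \<iota> :: "'k \<Rightarrow> 'K::field"
  assumes \<iota>: "\<iota> 0 = 0" "\<iota> 1 = 1" and U: "tensor_submodule \<Lambda> n \<iota> M U"
  shows "Module.module class_ring (hom_to_quotient \<Lambda> n M \<iota> U)"
  unfolding hom_to_quotient_def Let_def
proof (rule tensor_hom_is_module[OF quotient_vec_module[OF \<iota> U]])
  let ?V = "module_vec TYPE('K) n"
  let ?Q = "quotient_module ?V U"
  let ?\<beta> = "\<lambda>t. quotient_map ?V U (tensor_act n \<iota> M t)"
  note sub = U[unfolded tensor_submodule_def]
  note qt = quotient_map_tensor_act[OF \<iota> U]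
  have add: "(\<lambda>u. u + x) ` U \<oplus>\<^bsub>?Q\<^esub> (\<lambda>u. u + y) ` U = (\<lambda>u. u + (x + y)) ` U"
    if "x \<in> carrier_vec n" "y \<in> carrier_vec n" for x y
    using set_add_coset[OF \<iota> U that] by (simp add: quotient_module_def)
  have smult: "c \<odot>\<^bsub>?Q\<^esub> (\<lambda>u. u + y) ` U = (\<lambda>u. u + c \<cdot>\<^sub>v y) ` U" if "y \<in> carrier_vec n" for c y
    using quotient_map_smult_vec[OF \<iota> U that] by (simp add: quotient_module_def module_vec_simps)
  fix t :: "('l \<times> 'K) list" assume t: "t \<in> tensor_reps \<Lambda>"
  {
    fix C assume "C \<in> carrier ?Q"
    then obtain y where y: "y \<in> carrier_vec n" "C = (\<lambda>u. u + y) ` U"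
      by (auto simp: quotient_module_vec_carrier)
    show "?\<beta> t C \<in> carrier ?Q"
      using tensor_act_closed[OF t] by (auto simp: y qt[OF t] quotient_module_vec_carrier)
    show "?\<beta> t (c \<odot>\<^bsub>?Q\<^esub> C) = c \<odot>\<^bsub>?Q\<^esub> ?\<beta> t C" for c
      using y tensor_act_closed[OF t] by (simp add: qt[OF t] smult tensor_act_smult[OF t])
    fix D assume "D \<in> carrier ?Q"
    then obtain z where z: "z \<in> carrier_vec n" "D = (\<lambda>u. u + z) ` U"
      by (auto simp: quotient_module_vec_carrier)
    show "?\<beta> t (C \<oplus>\<^bsub>?Q\<^esub> D) = ?\<beta> t C \<oplus>\<^bsub>?Q\<^esub> ?\<beta> t D"
      using y z tensor_act_closed[OF t] by (simp add: qt[OF t] add tensor_act_add[OF t])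
  }
qed (use U in \<open>auto simp: tensor_submodule_def module_vec_simps\<close>)

text \<open>
  A homomorphism into the quotient is the same as a family of cosets of \<open>U\<close> whose total graph is stable
  under addition, scalars and \<open>\<Lambda>\<close>. This form refers only to representatives and to the
  generators of \<open>\<Lambda> \<otimes>\<^sub>k K\<close>. One direction uses that a coset is determined by any of its members.
\<close>

lemma hom_to_quotient_iff:
  fixes \<iota> :: "'k \<Rightarrow> 'K::field"
  assumes \<iota>: "\<iota> 0 = 0" "\<iota> 1 = 1" and tU: "tensor_submodule \<Lambda> n \<iota> M U"
  shows "\<theta> \<in> carrier (hom_to_quotient \<Lambda> n M \<iota> U) \<longleftrightarrow>
    \<theta> \<in> extensional U \<and>
    (\<forall>x\<in>U. \<exists>y\<in>carrier_vec n. \<theta> x = (\<lambda>u. u + y) ` U) \<and>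
    (\<forall>x\<in>U. \<forall>x'\<in>U. \<forall>y\<in>\<theta> x. \<forall>y'\<in>\<theta> x'. y + y' \<in> \<theta> (x + x')) \<and>
    (\<forall>c. \<forall>x\<in>U. \<forall>y\<in>\<theta> x. c \<cdot>\<^sub>v y \<in> \<theta> (c \<cdot>\<^sub>v x)) \<and>
    (\<forall>l\<in>carrier \<Lambda>. \<forall>x\<in>U. \<forall>y\<in>\<theta> x. map_mat \<iota> (M l) *\<^sub>v y \<in> \<theta> (map_mat \<iota> (M l) *\<^sub>v x))"
    (is "_ \<longleftrightarrow> ?ext \<and> ?cos \<and> ?add \<and> ?smult \<and> ?act")
proof -
  have U: "vec_submodule n U" and stable: "l \<in> carrier \<Lambda> \<Longrightarrow> x \<in> U \<Longrightarrow> map_mat \<iota> (M l) *\<^sub>v x \<in> U" for l x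
    using tU tensor_submodule_iff[OF \<iota>] by auto
  note UD = vec_submoduleD[OF U]
  note qt = quotient_map_tensor_act[OF \<iota> tU]
  let ?V = "module_vec TYPE('K) n"
  have H: "\<theta> \<in> carrier (hom_to_quotient \<Lambda> n M \<iota> U) \<longleftrightarrow>
    \<theta> \<in> extensional U \<and>
    (\<forall>x\<in>U. \<exists>y\<in>carrier_vec n. \<theta> x = (\<lambda>u. u + y) ` U) \<and>
    (\<forall>x\<in>U. \<forall>y\<in>U. \<theta> (x + y) = \<theta> x <+>\<^bsub>?V\<^esub> \<theta> y) \<and>
    (\<forall>t\<in>tensor_reps \<Lambda>. \<forall>x\<in>U. \<theta> (tensor_act n \<iota> M t x) = quotient_map ?V U (tensor_act n \<iota> M t) (\<theta> x))"
    (is "_ \<longleftrightarrow> _ \<and> _ \<and> ?add' \<and> ?act'")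
  proof -
    have "\<theta> \<in> U \<rightarrow>\<^sub>E {(\<lambda>u. u + y) ` U | y. y \<in> carrier_vec n} \<longleftrightarrow> ?ext \<and> ?cos"
      by (simp add: PiE_iff Bex_def conj_commute)
    moreover have "a_rcosets\<^bsub>?V\<^esub> U = {(\<lambda>u. u + y) ` U | y. y \<in> carrier_vec n}"
      using quotient_module_vec_carrier[of U] by (simp add: quotient_module_def)
    ultimately show ?thesis
      by (simp add: hom_to_quotient_def Let_def tensor_hom_def quotient_module_def module_vec_simps)
  qed
  show ?thesis
  proof
    assume "\<theta> \<in> carrier (hom_to_quotient \<Lambda> n M \<iota> U)"
    then have ext: ?ext and cos: ?cos and add: ?add' and act: ?act' using H by auto
    have cosE: "y \<in> carrier_vec n \<and> \<theta> x = (\<lambda>u. u + y) ` U" if xy: "x \<in> U" "y \<in> \<theta> x" for x y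
    proof -
      obtain z where z: "z \<in> carrier_vec n" "\<theta> x = (\<lambda>u. u + z) ` U" using cos xy(1) by blast
      with xy(2) have y: "y \<in> (\<lambda>u. u + z) ` U" by simp
      show ?thesis
        by (intro conjI coset_closed[OF U z(1) y] trans[OF z(2) coset_eq[OF U z(1) y]])
    qed
    have actI: "tensor_act n \<iota> M t y \<in> \<theta> (tensor_act n \<iota> M t x)"
      if "t \<in> tensor_reps \<Lambda>" "x \<in> U" "y \<in> \<theta> x" for t x y
    proof -
      have y: "y \<in> carrier_vec n" "\<theta> x = (\<lambda>u. u + y) ` U" using cosE[OF that(2,3)] by blast+
      have "\<theta> (tensor_act n \<iota> M t x) = quotient_map ?V U (tensor_act n \<iota> M t) (\<theta> x)"
        using act that by blast
      then show ?thesis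
        using y qt[OF that(1) y(1)] self_in_coset[OF U tensor_act_closed[OF that(1)]] by simp
    qed
    have ?add
    proof (intro ballI)
      fix x x' y y' assume *: "x \<in> U" "x' \<in> U" "y \<in> \<theta> x" "y' \<in> \<theta> x'"
      have y: "y \<in> carrier_vec n" "\<theta> x = (\<lambda>u. u + y) ` U" using cosE[OF *(1,3)] by blast+
      have y': "y' \<in> carrier_vec n" "\<theta> x' = (\<lambda>u. u + y') ` U" using cosE[OF *(2,4)] by blast+
      have "\<theta> (x + x') = \<theta> x <+>\<^bsub>?V\<^esub> \<theta> x'" using add * by blast
      then have "\<theta> (x + x') = (\<lambda>u. u + (y + y')) ` U"
        using y y' set_add_coset[OF \<iota> tU y(1) y'(1)] by simp
      then show "y + y' \<in> \<theta> (x + x')" using self_in_coset[OF U, of "y + y'"] y y' by simp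
    qed
    moreover have ?smult
    proof (intro allI ballI)
      fix c x y assume *: "x \<in> U" "y \<in> \<theta> x"
      have "y \<in> carrier_vec n" "x \<in> carrier_vec n" using cosE[OF *] UD(1)[OF *(1)] by blast+
      then show "c \<cdot>\<^sub>v y \<in> \<theta> (c \<cdot>\<^sub>v x)"
        using actI[of "[(\<one>\<^bsub>\<Lambda>\<^esub>, c)]" x y] * one_closed tensor_act_scalar[OF \<iota>]
        by (simp del: tensor_act.simps)
    qed
    moreover have ?act
    proof (intro ballI)
      fix l x y assume *: "l \<in> carrier \<Lambda>" "x \<in> U" "y \<in> \<theta> x"
      then show "map_mat \<iota> (M l) *\<^sub>v y \<in> \<theta> (map_mat \<iota> (M l) *\<^sub>v x)"
        using actI[of "[(l, 1)]" x y] tensor_act_pure[OF *(1), of \<iota>]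
        by (simp del: tensor_act.simps)
    qed
    ultimately show "?ext \<and> ?cos \<and> ?add \<and> ?smult \<and> ?act" using ext cos by blast
  next
    assume R: "?ext \<and> ?cos \<and> ?add \<and> ?smult \<and> ?act"
    have cosI: "\<theta> x = (\<lambda>u. u + y) ` U" if xy: "x \<in> U" "y \<in> \<theta> x" for x y
    proof -
      obtain z where z: "z \<in> carrier_vec n" "\<theta> x = (\<lambda>u. u + z) ` U" using R xy(1) by blast
      with xy(2) have y: "y \<in> (\<lambda>u. u + z) ` U" by simp
      show ?thesis by (rule trans[OF z(2) coset_eq[OF U z(1) y]])
    qed
    have act: "tensor_act n \<iota> M t y \<in> \<theta> (tensor_act n \<iota> M t x)"
      if "x \<in> U" "y \<in> carrier_vec n" "y \<in> \<theta> x" "t \<in> tensor_reps \<Lambda>" for t x y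
      using that(4)
    proof (induction t)
      case Nil
      \<comment> \<open>The empty list acts as zero, and so does the scalar \<open>0\<close>.\<close>
    have "0 \<cdot>\<^sub>v y \<in> \<theta> (0 \<cdot>\<^sub>v x)" using R that by blast
      moreover have "0 \<cdot>\<^sub>v z = 0\<^sub>v n" if "z \<in> carrier_vec n" for z :: "'K vec"
        using that by (intro eq_vecI) auto
      ultimately show ?case using UD(1)[OF that(1)] that(2) by simp
    next
      case (Cons p t)
      then have p: "fst p \<in> carrier \<Lambda>" and t: "t \<in> tensor_reps \<Lambda>" by auto
      have "snd p \<cdot>\<^sub>v (map_mat \<iota> (M (fst p)) *\<^sub>v y) \<in> \<theta> (snd p \<cdot>\<^sub>v (map_mat \<iota> (M (fst p)) *\<^sub>v x))"
        using R that p stable by blast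
      moreover have "tensor_act n \<iota> M t x \<in> U"
        using tensor_act_mem[OF U stable t that(1)] .
      ultimately show ?case
        using R Cons.IH UD(4)[OF stable[OF p that(1)]] by simp
    qed
    have "?add'"
    proof (intro ballI)
      fix x y assume *: "x \<in> U" "y \<in> U"
      obtain a b where a: "a \<in> carrier_vec n" "\<theta> x = (\<lambda>u. u + a) ` U"
        and b: "b \<in> carrier_vec n" "\<theta> y = (\<lambda>u. u + b) ` U" using R * by meson
      have "a \<in> \<theta> x" "b \<in> \<theta> y" using a b self_in_coset[OF U] by auto
      then have "a + b \<in> \<theta> (x + y)" using R * by blast
      then have "\<theta> (x + y) = (\<lambda>u. u + (a + b)) ` U" using cosI UD(3) * by blast
      then show "\<theta> (x + y) = \<theta> x <+>\<^bsub>?V\<^esub> \<theta> y"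
        using a b set_add_coset[OF \<iota> tU a(1) b(1)] by simp
    qed
    moreover have "?act'"
    proof (intro ballI)
      fix t :: "('l \<times> 'K) list" and x assume *: "t \<in> tensor_reps \<Lambda>" "x \<in> U"
      obtain a where a: "a \<in> carrier_vec n" "\<theta> x = (\<lambda>u. u + a) ` U" using R * by meson
      have "tensor_act n \<iota> M t a \<in> \<theta> (tensor_act n \<iota> M t x)"
        using act[of x a t] * a self_in_coset[OF U a(1)] by simp
      then have "\<theta> (tensor_act n \<iota> M t x) = (\<lambda>u. u + tensor_act n \<iota> M t a) ` U"
        using cosI tensor_act_mem[OF U stable *] by blast
      then show "\<theta> (tensor_act n \<iota> M t x) = quotient_map ?V U (tensor_act n \<iota> M t) (\<theta> x)"
        using a qt[OF *(1) a(1)] by simp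
    qed
    ultimately show "\<theta> \<in> carrier (hom_to_quotient \<Lambda> n M \<iota> U)" using H R by blast
  qed
qed

end


section \<open>Square-zero extensions\<close>

text \<open>
  The ring \<open>K \<oplus> K\<^sup>J\<close>, in which the product of any two elements of \<open>K\<^sup>J\<close> is zero, described by its
  coordinates: \<open>pr\<close> is the residue map, \<open>D j\<close> is the coefficient of the \<open>j\<close>-th infinitesimal \<open>\<epsilon>\<^sub>j\<close>, and
  \<open>mk a b\<close> is \<open>a + \<Sum>\<^sub>j b\<^sub>j\<epsilon>\<^sub>j\<close>. With one infinitesimal these are the dual numbers.
\<close>

locale square_zero_extension =
  fixes pr :: "'r::comm_ring_1 \<Rightarrow> 'K::comm_ring_1"
    and D :: "'j::finite \<Rightarrow> 'r \<Rightarrow> 'K"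
    and mk :: "'K \<Rightarrow> ('j \<Rightarrow> 'K) \<Rightarrow> 'r"
  assumes pr_add: "pr (r + s) = pr r + pr s"
    and pr_mult: "pr (r * s) = pr r * pr s"
    and pr_one: "pr 1 = 1"
    and D_add: "D j (r + s) = D j r + D j s"
    and D_mult: "D j (r * s) = pr r * D j s + D j r * pr s"
    and pr_mk [simp]: "pr (mk a b) = a"
    and D_mk [simp]: "D j (mk a b) = b j"
    and mk_eta: "mk (pr r) (\<lambda>j. D j r) = r"
begin

lemma ext_eqI:
  assumes "pr r = pr s" "\<And>j. D j r = D j s"
  shows "r = s"
proof -
  have "mk (pr r) (\<lambda>j. D j r) = mk (pr s) (\<lambda>j. D j s)"
    using assms by (intro arg_cong2[of _ _ _ _ mk]) auto
  then show ?thesis unfolding mk_eta .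
qed

lemma pr_zero [simp]: "pr 0 = 0"
  using pr_add[of 0 0] by simp

lemma D_zero [simp]: "D j 0 = 0"
  using D_add[of j 0 0] by simp

lemma D_one: "D j 1 = 0"
  using D_mult[of j 1 1] by (simp add: pr_one)

lemma mk_zero: "mk 0 (\<lambda>_. 0) = 0"
  by (rule ext_eqI) auto

lemma mk_one: "mk 1 (\<lambda>_. 0) = 1"
  by (rule ext_eqI) (auto simp: pr_one D_one)

lemma pr_diff: "pr (r - s) = pr r - pr s"
  using pr_add[of "r - s" s] by (simp add: algebra_simps)

lemma D_diff: "D j (r - s) = D j r - D j s"
  using D_add[of j "r - s" s] by (simp add: algebra_simps)

lemma pr_sum: "pr (\<Sum>i\<in>A. f i) = (\<Sum>i\<in>A. pr (f i))"
  by (induction A rule: infinite_finite_induct) (auto simp: pr_add)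

lemma D_sum: "D j (\<Sum>i\<in>A. f i) = (\<Sum>i\<in>A. D j (f i))"
  by (induction A rule: infinite_finite_induct) (auto simp: D_add)

abbreviation "prv \<equiv> map_vec pr"
abbreviation "Dv j \<equiv> map_vec (D j)"

text \<open>
  The vector \<open>x + \<Sum>\<^sub>j \<epsilon>\<^sub>jy\<^sub>j\<close>.
\<close>

definition mkv :: "nat \<Rightarrow> 'K vec \<Rightarrow> ('j \<Rightarrow> 'K vec) \<Rightarrow> 'r vec" where
  "mkv n x y = vec n (\<lambda>i. mk (x $ i) (\<lambda>j. y j $ i))"

lemma mkv_closed [simp]: "mkv n x y \<in> carrier_vec n"
  by (simp add: mkv_def)

lemma prv_mkv: "x \<in> carrier_vec n \<Longrightarrow> prv (mkv n x y) = x"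
  by (intro eq_vecI) (auto simp: mkv_def)

lemma Dv_mkv: "y j \<in> carrier_vec n \<Longrightarrow> Dv j (mkv n x y) = y j"
  by (intro eq_vecI) (auto simp: mkv_def)

lemma ext_vec_eqI:
  assumes "v \<in> carrier_vec n" "w \<in> carrier_vec n" "prv v = prv w" "\<And>j. Dv j v = Dv j w"
  shows "v = w"
proof (rule eq_vecI)
  show "v $ i = w $ i" if "i < dim_vec w" for i
  proof (rule ext_eqI)
    have "i < dim_vec v" using that assms by simp
    then show "pr (v $ i) = pr (w $ i)" "D j (v $ i) = D j (w $ i)" for j
      using that arg_cong[OF assms(3), of "\<lambda>x. x $ i"] arg_cong[OF assms(4)[of j], of "\<lambda>x. x $ i"]
      by simp_all
  qed
qed (use assms in auto)

lemma prv_zero [simp]: "prv (0\<^sub>v n) = 0\<^sub>v n"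
  by (intro eq_vecI) auto

lemma Dv_zero [simp]: "Dv j (0\<^sub>v n) = 0\<^sub>v n"
  by (intro eq_vecI) auto

lemma prv_add: "\<lbrakk>v \<in> carrier_vec n; w \<in> carrier_vec n\<rbrakk> \<Longrightarrow> prv (v + w) = prv v + prv w"
  by (intro eq_vecI) (auto simp: pr_add)

lemma Dv_add: "\<lbrakk>v \<in> carrier_vec n; w \<in> carrier_vec n\<rbrakk> \<Longrightarrow> Dv j (v + w) = Dv j v + Dv j w"
  by (intro eq_vecI) (auto simp: D_add)

lemma prv_diff: "\<lbrakk>v \<in> carrier_vec n; w \<in> carrier_vec n\<rbrakk> \<Longrightarrow> prv (v - w) = prv v - prv w"
  by (intro eq_vecI) (auto simp: pr_diff)

lemma Dv_diff: "\<lbrakk>v \<in> carrier_vec n; w \<in> carrier_vec n\<rbrakk> \<Longrightarrow> Dv j (v - w) = Dv j v - Dv j w"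
  by (intro eq_vecI) (auto simp: D_diff)

lemma prv_smult: "prv (c \<cdot>\<^sub>v v) = pr c \<cdot>\<^sub>v prv v"
  by (intro eq_vecI) (auto simp: pr_mult)

lemma Dv_smult: "Dv j (c \<cdot>\<^sub>v v) = pr c \<cdot>\<^sub>v Dv j v + D j c \<cdot>\<^sub>v prv v"
  by (intro eq_vecI) (auto simp: D_mult)

lemma prv_mult_const_mat:
  assumes "A \<in> carrier_mat m n" "v \<in> carrier_vec n"
  shows "prv (map_mat (\<lambda>a. mk (f a) (\<lambda>_. 0)) A *\<^sub>v v) = map_mat f A *\<^sub>v prv v"
  using assms by (intro eq_vecI) (auto simp: scalar_prod_def pr_sum pr_mult)

lemma Dv_mult_const_mat:
  assumes "A \<in> carrier_mat m n" "v \<in> carrier_vec n"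
  shows "Dv j (map_mat (\<lambda>a. mk (f a) (\<lambda>_. 0)) A *\<^sub>v v) = map_mat f A *\<^sub>v Dv j v"
  using assms by (intro eq_vecI) (auto simp: scalar_prod_def D_sum D_mult)

text \<open>
  The vector \<open>\<epsilon>\<^sub>jy\<close>.
\<close>

definition eps_vec :: "nat \<Rightarrow> 'j \<Rightarrow> 'K vec \<Rightarrow> 'r vec" where
  "eps_vec n j y = mkv n (0\<^sub>v n) (\<lambda>i. if i = j then y else 0\<^sub>v n)"

lemma prv_eps_vec [simp]: "prv (eps_vec n j y) = 0\<^sub>v n"
  by (simp add: eps_vec_def prv_mkv)

lemma Dv_eps_vec: "y \<in> carrier_vec n \<Longrightarrow> Dv i (eps_vec n j y) = (if i = j then y else 0\<^sub>v n)"
  unfolding eps_vec_def by (subst Dv_mkv) auto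

lemma eps_vec_closed [simp]: "eps_vec n j y \<in> carrier_vec n"
  by (simp add: eps_vec_def)

lemma eps_vec_eq_smult:
  assumes "v \<in> carrier_vec n"
  shows "eps_vec n j (prv v) = mk 0 (\<lambda>i. if i = j then 1 else 0) \<cdot>\<^sub>v v"
proof (rule ext_vec_eqI[of _ n])
  fix i
  show "Dv i (eps_vec n j (prv v)) = Dv i (mk 0 (\<lambda>i. if i = j then 1 else 0) \<cdot>\<^sub>v v)"
    using assms by (subst Dv_eps_vec) (auto simp: Dv_smult intro!: eq_vecI)
qed (use assms in \<open>auto simp: prv_smult intro!: eq_vecI\<close>)

text \<open>
  This is the expansion \<open>\<Sum>\<^sub>j \<epsilon>\<^sub>jy\<^sub>j\<close>, summed by induction over the finitely many infinitesimals.
\<close>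

lemma eps_vecs_mem:
  assumes S: "vec_submodule n S" and y: "\<And>j. y j \<in> carrier_vec n"
    and mem: "\<And>j. eps_vec n j (y j) \<in> S"
  shows "mkv n (0\<^sub>v n) y \<in> S"
proof -
  let ?y = "\<lambda>F j. if j \<in> F then y j else 0\<^sub>v n"
  have "mkv n (0\<^sub>v n) (?y F) \<in> S" if "finite F" for F
    using that
  proof (induction F rule: finite_induct)
    case empty
    have "mkv n (0\<^sub>v n) (?y {}) = 0\<^sub>v n"
      by (intro ext_vec_eqI[of _ n]) (auto simp: prv_mkv Dv_mkv)
    then show ?case using vec_submoduleD(2)[OF S] by simp
  next
    case (insert i F)
    have "mkv n (0\<^sub>v n) (?y (insert i F)) = mkv n (0\<^sub>v n) (?y F) + eps_vec n i (y i)"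
      using insert.hyps y
      by (intro ext_vec_eqI[of _ n])
        (auto simp: prv_add[of _ n] Dv_add[of _ n] prv_mkv Dv_mkv Dv_eps_vec)
    then show ?case using vec_submoduleD(3)[OF S insert.IH mem] by simp
  qed
  from this[of UNIV] show ?thesis by simp
qed

end


section \<open>Bases and rank\<close>

lemma finsum_vec_eq:
  fixes u :: "nat \<Rightarrow> 'r::comm_ring_1 vec"
  assumes "\<And>i. i < d \<Longrightarrow> u i \<in> carrier_vec n"
  shows "finsum_vec TYPE('r) n (\<lambda>i. c i \<cdot>\<^sub>v u i) {..<d} = vec n (\<lambda>k. \<Sum>i<d. c i * u i $ k)"
proof -
  have car: "(\<lambda>i. c i \<cdot>\<^sub>v u i) \<in> {..<d} \<rightarrow> carrier_vec n" using assms by auto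
  show ?thesis
  proof (rule eq_vecI)
    fix k assume "k < dim_vec (vec n (\<lambda>k. \<Sum>i<d. c i * u i $ k))"
    then have k: "k < n" by simp
    have "k < dim_vec (u i)" if "i < d" for i using assms[OF that] k by simp
    then show "finsum_vec TYPE('r) n (\<lambda>i. c i \<cdot>\<^sub>v u i) {..<d} $ k = vec n (\<lambda>k. \<Sum>i<d. c i * u i $ k) $ k"
      using k by (subst index_finsum_vec[OF finite_lessThan k car]) simp
  qed (use finsum_vec_closed[OF car] in auto)
qed

text \<open>
  The linear combinations are written out in coordinates, so that ring homomorphisms and the
  coefficient maps \<open>D j\<close> can be applied entry by entry.
\<close>

definition basis_of :: "nat \<Rightarrow> 'r::comm_ring_1 vec set \<Rightarrow> nat \<Rightarrow> (nat \<Rightarrow> 'r vec) \<Rightarrow> bool" where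
  "basis_of n U d u \<longleftrightarrow> (\<forall>i<d. u i \<in> U) \<and>
     (\<forall>x\<in>U. \<exists>c. x = vec n (\<lambda>k. \<Sum>i<d. c i * u i $ k)) \<and>
     (\<forall>c. vec n (\<lambda>k. \<Sum>i<d. c i * u i $ k) = 0\<^sub>v n \<longrightarrow> (\<forall>i<d. c i = 0))"

text \<open>
  A global basis serves at every prime, with denominator \<open>1\<close>.
\<close>

lemma basis_of_imp_has_rank:
  assumes U: "U \<subseteq> carrier_vec n" and u: "basis_of n (U :: 'r::comm_ring_1 vec set) d u"
  shows "has_rank n U d"
  unfolding has_rank_def
proof (intro allI impI exI[of _ u] conjI)
  fix P :: "'r set" assume "primeideal P class_ring"
  then interpret primeideal P class_ring .
  have one: "1 \<notin> P" using one_imp_carrier I_notcarr by auto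
  have car: "u i \<in> carrier_vec n" if "i < d" for i using U u that by (auto simp: basis_of_def)
  have eq: "finsum_vec TYPE('r) n (\<lambda>i. c i \<cdot>\<^sub>v u i) {..<d} = vec n (\<lambda>k. \<Sum>i<d. c i * u i $ k)" for c
    using finsum_vec_eq car by blast
  show "u i \<in> U" if "i < d" for i using u that by (simp add: basis_of_def)
  show "\<forall>x\<in>U. \<exists>s c. s \<notin> P \<and> s \<cdot>\<^sub>v x = finsum_vec TYPE('r) n (\<lambda>i. c i \<cdot>\<^sub>v u i) {..<d}"
    unfolding eq
  proof
    fix x assume "x \<in> U"
    then obtain c where "x = vec n (\<lambda>k. \<Sum>i<d. c i * u i $ k)" using u by (auto simp: basis_of_def)
    then show "\<exists>s c. s \<notin> P \<and> s \<cdot>\<^sub>v x = vec n (\<lambda>k. \<Sum>i<d. c i * u i $ k)"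
      using one by (intro exI[of _ 1] exI[of _ c]) auto
  qed
  fix c assume "finsum_vec TYPE('r) n (\<lambda>i. c i \<cdot>\<^sub>v u i) {..<d} = 0\<^sub>v n"
  then have "\<forall>i<d. c i = 0" using u unfolding eq basis_of_def by blast
  then show "\<exists>s. s \<notin> P \<and> (\<forall>i<d. s * c i = 0)" using one by auto
qed

text \<open>
  Over a field the zero ideal is prime and everything outside of it is invertible, so a local basis
  at this prime is a basis.
\<close>

lemma has_rank_field_imp_basis:
  assumes U: "U \<subseteq> carrier_vec n" and rank: "has_rank n (U :: 'K::field vec set) d"
  obtains u where "basis_of n U d u"
proof -
  have "domain (class_ring :: 'K ring)"
    using class_field[where 'a='K] by (simp add: field_def)
  then have "primeideal {0} (class_ring :: 'K ring)"
    using domain.zeroprimeideal by fastforce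
  then obtain u where u: "\<And>i. i < d \<Longrightarrow> u i \<in> U"
    and span: "\<forall>x\<in>U. \<exists>s c. s \<notin> {0} \<and> s \<cdot>\<^sub>v x = finsum_vec TYPE('K) n (\<lambda>i. c i \<cdot>\<^sub>v u i) {..<d}"
    and indep: "\<forall>c. finsum_vec TYPE('K) n (\<lambda>i. c i \<cdot>\<^sub>v u i) {..<d} = 0\<^sub>v n \<longrightarrow>
      (\<exists>s. s \<notin> {0} \<and> (\<forall>i<d. s * c i = 0))"
    using rank unfolding has_rank_def by blast
  have eq: "finsum_vec TYPE('K) n (\<lambda>i. c i \<cdot>\<^sub>v u i) {..<d} = vec n (\<lambda>k. \<Sum>i<d. c i * u i $ k)" for c
    using finsum_vec_eq u U by blast
  have "\<exists>c. x = vec n (\<lambda>k. \<Sum>i<d. c i * u i $ k)" if x: "x \<in> U" for x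
  proof -
    obtain s c where s: "s \<noteq> 0" "s \<cdot>\<^sub>v x = vec n (\<lambda>k. \<Sum>i<d. c i * u i $ k)"
      using span x unfolding eq by auto
    have "x = inverse s \<cdot>\<^sub>v (s \<cdot>\<^sub>v x)" using s(1) by (simp add: smult_smult_assoc)
    also have "\<dots> = vec n (\<lambda>k. \<Sum>i<d. (inverse s * c i) * u i $ k)"
      unfolding s(2) by (intro eq_vecI) (auto simp: sum_distrib_left mult.assoc)
    finally show ?thesis by (intro exI[of _ "\<lambda>i. inverse s * c i"])
  qed
  moreover have "\<forall>i<d. c i = 0" if "vec n (\<lambda>k. \<Sum>i<d. c i * u i $ k) = 0\<^sub>v n" for c
    using indep that unfolding eq by fastforce
  ultimately have "basis_of n U d u" unfolding basis_of_def using u by blast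
  then show ?thesis using that by blast
qed

lemma combinations_submodule:
  "vec_submodule n {vec n (\<lambda>k. \<Sum>i<d. c i * u i $ k) | c. True}" (is "vec_submodule n ?S")
  unfolding vec_submodule_iff
proof (intro conjI ballI allI)
  show "?S \<subseteq> carrier_vec n" by auto
  show "0\<^sub>v n \<in> ?S" by (rule CollectI, rule exI[of _ "\<lambda>_. 0"]) auto
  fix x assume "x \<in> ?S"
  then obtain c where c: "x = vec n (\<lambda>k. \<Sum>i<d. c i * u i $ k)" by auto
  have "a \<cdot>\<^sub>v x = vec n (\<lambda>k. \<Sum>i<d. (a * c i) * u i $ k)" for a
    unfolding c by (intro eq_vecI) (auto simp: sum_distrib_left mult.assoc)
  then show "a \<cdot>\<^sub>v x \<in> ?S" for a by auto
  fix y assume "y \<in> ?S"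
  then obtain b where b: "y = vec n (\<lambda>k. \<Sum>i<d. b i * u i $ k)" by auto
  have "x + y = vec n (\<lambda>k. \<Sum>i<d. (c i + b i) * u i $ k)"
    unfolding c b by (intro eq_vecI) (auto simp: sum.distrib algebra_simps)
  then show "x + y \<in> ?S" by auto
qed


section \<open>Spans and the maps between Grassmannians\<close>

text \<open>
  The span is used only through its universal property, as the least submodule that contains the given
  vectors. Hypothesis \<open>least\<close> is the form in which Nakayama's lemma applies.
\<close>

lemma span_eq:
  assumes S: "S \<subseteq> V" and V: "vec_submodule n (V :: 'r::comm_ring_1 vec set)"
    and least: "\<And>W. \<lbrakk>vec_submodule n W; S \<subseteq> W; W \<subseteq> V\<rbrakk> \<Longrightarrow> W = V"
  shows "LinearCombinations.module.span class_ring (module_vec TYPE('r) n) S = V"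
proof -
  interpret Vn: Module.module class_ring "module_vec TYPE('r) n" by (rule module_vec_module)
  have Sc: "S \<subseteq> carrier (module_vec TYPE('r) n)"
    using S vec_submoduleD(1)[OF V] by (auto simp: module_vec_simps)
  show ?thesis
    by (intro least Vn.span_is_submodule Vn.in_own_span Vn.span_is_subset S V Sc)
qed

lemma Gr_map_superset:
  assumes "V \<subseteq> carrier_vec n"
  shows "map_vec \<psi> ` V \<subseteq> Gr_map n (\<psi> :: 'r::comm_ring_1 \<Rightarrow> 's::comm_ring_1) V"
proof -
  interpret Vn: Module.module class_ring "module_vec TYPE('s) n" by (rule module_vec_module)
  show ?thesis
    unfolding Gr_map_def using assms by (intro Vn.in_own_span) (auto simp: module_vec_simps)
qed

lemma Gr_map_subset:
  assumes "vec_submodule n S" "map_vec \<psi> ` V \<subseteq> S"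
  shows "Gr_map n (\<psi> :: 'r::comm_ring_1 \<Rightarrow> 's::comm_ring_1) V \<subseteq> S"
proof -
  interpret Vn: Module.module class_ring "module_vec TYPE('s) n" by (rule module_vec_module)
  show ?thesis
    unfolding Gr_map_def by (rule Vn.span_is_subset[OF assms(2,1)])
qed


section \<open>Homomorphisms into the quotient as families of cosets\<close>

locale grassmannian_point = module_structure \<Lambda> n M
  for \<Lambda> :: "('k::field, 'l) module" and n :: nat and M :: "'l \<Rightarrow> 'k mat" +
  fixes d :: nat and \<iota> :: "'k \<Rightarrow> 'K::field" and U :: "'K vec set"
  assumes \<iota>_zero: "\<iota> 0 = 0" and \<iota>_one: "\<iota> 1 = 1"
    and point: "U \<in> Gr_points \<Lambda> d n M \<iota>"
begin

abbreviation Hom :: "('K vec \<Rightarrow> 'K vec set) set" where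
  "Hom \<equiv> carrier (hom_to_quotient \<Lambda> n M \<iota> U)"

abbreviation act :: "'l \<Rightarrow> 'K vec \<Rightarrow> 'K vec" where
  "act l x \<equiv> map_mat \<iota> (M l) *\<^sub>v x"

lemma tensor_sub: "tensor_submodule \<Lambda> n \<iota> M U"
  using point by (simp add: Gr_points_def)

lemma U_sub: "vec_submodule n U"
  using iffD1[OF tensor_submodule_iff[of \<iota>, OF \<iota>_zero \<iota>_one] tensor_sub] by simp

lemmas UD = vec_submoduleD[OF U_sub]

lemma act_U: "\<lbrakk>l \<in> carrier \<Lambda>; x \<in> U\<rbrakk> \<Longrightarrow> act l x \<in> U"
  using iffD1[OF tensor_submodule_iff[of \<iota>, OF \<iota>_zero \<iota>_one] tensor_sub] by simp

lemmas Hom_iff = hom_to_quotient_iff[of \<iota>, OF \<iota>_zero \<iota>_one tensor_sub]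

lemma HomD:
  assumes "\<theta> \<in> Hom"
  shows Hom_extensional: "\<theta> \<in> extensional U"
    and "x \<in> U \<Longrightarrow> \<exists>y\<in>carrier_vec n. \<theta> x = (\<lambda>u. u + y) ` U"
    and Hom_add: "\<lbrakk>x \<in> U; x' \<in> U; y \<in> \<theta> x; y' \<in> \<theta> x'\<rbrakk> \<Longrightarrow> y + y' \<in> \<theta> (x + x')"
    and Hom_smult: "\<lbrakk>x \<in> U; y \<in> \<theta> x\<rbrakk> \<Longrightarrow> c \<cdot>\<^sub>v y \<in> \<theta> (c \<cdot>\<^sub>v x)"
    and Hom_act: "\<lbrakk>l \<in> carrier \<Lambda>; x \<in> U; y \<in> \<theta> x\<rbrakk> \<Longrightarrow> act l y \<in> \<theta> (act l x)"
  using iffD1[OF Hom_iff assms] by simp_all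

lemma Hom_coset:
  assumes "\<theta> \<in> Hom" "x \<in> U"
  obtains y where "y \<in> carrier_vec n" "\<theta> x = (\<lambda>u. u + y) ` U"
  using HomD(2)[OF assms] by (elim bexE)

lemma Hom_nonempty:
  assumes "\<theta> \<in> Hom" "x \<in> U"
  shows "\<exists>y. y \<in> \<theta> x"
proof -
  obtain y where y: "y \<in> carrier_vec n" "\<theta> x = (\<lambda>u. u + y) ` U" using Hom_coset[OF assms] .
  then show ?thesis using self_in_coset[OF U_sub y(1)] by auto
qed

lemma Hom_closed:
  assumes "\<theta> \<in> Hom" "x \<in> U" "y \<in> \<theta> x"
  shows "y \<in> carrier_vec n"
proof -
  obtain z where z: "z \<in> carrier_vec n" "\<theta> x = (\<lambda>u. u + z) ` U" using Hom_coset[OF assms(1,2)] .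
  then show ?thesis using coset_closed[OF U_sub z(1)] assms(3) by simp
qed

lemma Hom_diff:
  assumes "\<theta> \<in> Hom" "x \<in> U" "y \<in> \<theta> x" "y' \<in> \<theta> x"
  shows "y - y' \<in> U"
proof -
  obtain z where z: "z \<in> carrier_vec n" "\<theta> x = (\<lambda>u. u + z) ` U" using Hom_coset[OF assms(1,2)] .
  then show ?thesis using coset_diff[OF U_sub z(1)] assms(3,4) by simp
qed

lemma Hom_shift:
  assumes "\<theta> \<in> Hom" "x \<in> U" "y \<in> \<theta> x" "u \<in> U"
  shows "y + u \<in> \<theta> x"
proof -
  obtain z where z: "z \<in> carrier_vec n" "\<theta> x = (\<lambda>u. u + z) ` U" using Hom_coset[OF assms(1,2)] .
  then show ?thesis using coset_add[OF U_sub z(1) _ assms(4)] assms(3) by simp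
qed

lemma Hom_eq_coset:
  assumes "\<theta> \<in> Hom" "x \<in> U" "y \<in> \<theta> x"
  shows "\<theta> x = (\<lambda>u. u + y) ` U"
proof -
  obtain z where z: "z \<in> carrier_vec n" "\<theta> x = (\<lambda>u. u + z) ` U" using Hom_coset[OF assms(1,2)] .
  then have "y \<in> (\<lambda>u. u + z) ` U" using assms(3) by simp
  then show ?thesis using z(2) coset_eq[OF U_sub z(1)] by metis
qed

lemma Hom_zero:
  assumes "\<theta> \<in> Hom"
  shows "\<theta> (0\<^sub>v n) = U"
proof -
  obtain y where y: "y \<in> \<theta> (0\<^sub>v n)" using Hom_nonempty[OF assms UD(2)] by blast
  have y_car: "y \<in> carrier_vec n" using Hom_closed[OF assms UD(2) y] .
  have "0 \<cdot>\<^sub>v y \<in> \<theta> (0 \<cdot>\<^sub>v 0\<^sub>v n)" using Hom_smult[OF assms UD(2) y] .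
  moreover have "0 \<cdot>\<^sub>v y = 0\<^sub>v n" "0 \<cdot>\<^sub>v 0\<^sub>v n = (0\<^sub>v n :: 'K vec)" using y_car by (auto intro!: eq_vecI)
  ultimately have "0\<^sub>v n \<in> \<theta> (0\<^sub>v n)" by simp
  from Hom_eq_coset[OF assms UD(2) this] show ?thesis using coset_zero[OF U_sub] by metis
qed

text \<open>
  Distinct cosets of \<open>U\<close> are disjoint, so one inclusion at each argument already gives equality.
\<close>

lemma Hom_eqI:
  assumes "\<theta> \<in> Hom" "\<theta>' \<in> Hom" "\<And>x. x \<in> U \<Longrightarrow> \<theta> x \<subseteq> \<theta>' x"
  shows "\<theta> = \<theta>'"
proof (rule extensionalityI)
  show "\<theta> \<in> extensional U" "\<theta>' \<in> extensional U" using assms(1,2) by (simp_all add: Hom_extensional)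
  fix x assume x: "x \<in> U"
  obtain y where y: "y \<in> \<theta> x" using Hom_nonempty[OF assms(1) x] by blast
  then have "y \<in> \<theta>' x" using assms(3)[OF x] by blast
  then show "\<theta> x = \<theta>' x"
    using Hom_eq_coset[OF assms(1) x y] Hom_eq_coset[OF assms(2) x] by metis
qed

end


section \<open>Points over a square-zero extension\<close>

locale deformation =
  grassmannian_point \<Lambda> n M d \<iota> U + square_zero_extension pr D mk
  for \<Lambda> :: "('k::field, 'l) module" and n :: nat and M :: "'l \<Rightarrow> 'k mat"
    and d :: nat and \<iota> :: "'k \<Rightarrow> 'K::field" and U :: "'K vec set"
    and pr :: "'r::comm_ring_1 \<Rightarrow> 'K" and D :: "'j::finite \<Rightarrow> 'r \<Rightarrow> 'K" and mk
begin

abbreviation \<phi> :: "'k \<Rightarrow> 'r" where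
  "\<phi> \<equiv> \<lambda>a. mk (\<iota> a) (\<lambda>_. 0)"

lemma \<phi>_zero: "\<phi> 0 = 0" and \<phi>_one: "\<phi> 1 = 1"
  by (simp_all add: \<iota>_zero \<iota>_one mk_zero mk_one)

lemmas tensor_submodule_ext_iff = tensor_submodule_iff[of \<phi>, OF \<phi>_zero \<phi>_one]

lemma prv_act: "\<lbrakk>l \<in> carrier \<Lambda>; v \<in> carrier_vec n\<rbrakk> \<Longrightarrow> prv (map_mat \<phi> (M l) *\<^sub>v v) = act l (prv v)"
  using prv_mult_const_mat[OF M_closed] .

lemma Dv_act: "\<lbrakk>l \<in> carrier \<Lambda>; v \<in> carrier_vec n\<rbrakk> \<Longrightarrow> Dv j (map_mat \<phi> (M l) *\<^sub>v v) = act l (Dv j v)"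
  using Dv_mult_const_mat[OF M_closed] .

text \<open>
  The common graph of the homomorphisms \<open>\<theta>\<^sub>j\<close>, that is the set of all \<open>x + \<Sum>\<^sub>j \<epsilon>\<^sub>jy\<^sub>j\<close> with \<open>x \<in> U\<close> and
  \<open>y\<^sub>j \<in> \<theta>\<^sub>j(x)\<close>.
\<close>

definition lift :: "('j \<Rightarrow> 'K vec \<Rightarrow> 'K vec set) \<Rightarrow> 'r vec set" where
  "lift \<theta> = {v \<in> carrier_vec n. prv v \<in> U \<and> (\<forall>j. Dv j v \<in> \<theta> j (prv v))}"

lemma liftI: "\<lbrakk>v \<in> carrier_vec n; prv v \<in> U; \<And>j. Dv j v \<in> \<theta> j (prv v)\<rbrakk> \<Longrightarrow> v \<in> lift \<theta>"
  by (simp add: lift_def)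

lemma liftD:
  assumes "v \<in> lift \<theta>"
  shows "v \<in> carrier_vec n" "prv v \<in> U" "Dv j v \<in> \<theta> j (prv v)"
  using assms by (auto simp: lift_def)

context
  fixes \<theta> :: "'j \<Rightarrow> 'K vec \<Rightarrow> 'K vec set"
  assumes \<theta>: "\<And>j. \<theta> j \<in> Hom"
begin

text \<open>
  For scalars, \<open>c = a + \<Sum>\<^sub>j b\<^sub>j\<epsilon>\<^sub>j\<close> sends \<open>y\<^sub>j\<close> to \<open>ay\<^sub>j + b\<^sub>jx\<close>, and the extra term \<open>b\<^sub>jx\<close> is absorbed because it lies in \<open>U\<close>.
\<close>

lemma lift_submodule: "vec_submodule n (lift \<theta>)"
  unfolding vec_submodule_iff
proof (intro conjI ballI allI)
  show "lift \<theta> \<subseteq> carrier_vec n" by (auto simp: lift_def)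
  show "0\<^sub>v n \<in> lift \<theta>"
    by (rule liftI) (use Hom_zero[OF \<theta>] UD(2) in auto)
  fix v assume "v \<in> lift \<theta>"
  note v = liftD[OF this]
  show "c \<cdot>\<^sub>v v \<in> lift \<theta>" for c
  proof (rule liftI)
    show "Dv j (c \<cdot>\<^sub>v v) \<in> \<theta> j (prv (c \<cdot>\<^sub>v v))" for j
      unfolding Dv_smult prv_smult
      by (intro Hom_shift Hom_smult \<theta> UD(4) v)
  qed (use v UD(4) in \<open>auto simp: prv_smult\<close>)
  fix w assume "w \<in> lift \<theta>"
  note w = liftD[OF this]
  show "v + w \<in> lift \<theta>"
    by (rule liftI)
      (use v w UD(3) Hom_add[OF \<theta>] in \<open>auto simp: prv_add[OF v(1) w(1)] Dv_add[OF v(1) w(1)]\<close>)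
qed

lemma lift_tensor_submodule: "tensor_submodule \<Lambda> n \<phi> M (lift \<theta>)"
  unfolding tensor_submodule_ext_iff
proof (intro conjI ballI lift_submodule)
  fix l v assume l: "l \<in> carrier \<Lambda>" and "v \<in> lift \<theta>"
  note v = liftD[OF this(2)]
  show "map_mat \<phi> (M l) *\<^sub>v v \<in> lift \<theta>"
    by (rule liftI)
      (use l v act_U Hom_act[OF \<theta>] in \<open>auto simp: prv_act[OF l v(1)] Dv_act[OF l v(1)]\<close>)
qed

lemma lift_surj:
  assumes x: "x \<in> U"
  obtains v where "v \<in> lift \<theta>" "prv v = x"
proof -
  obtain y where y: "\<And>j. y j \<in> \<theta> j x" using Hom_nonempty[OF \<theta> x] by metis
  have xc: "x \<in> carrier_vec n" and yc: "y j \<in> carrier_vec n" for j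
    using UD(1)[OF x] Hom_closed[OF \<theta> x y] by auto
  have "mkv n x y \<in> lift \<theta>"
    by (rule liftI) (use x y in \<open>auto simp: prv_mkv[OF xc] Dv_mkv[OF yc]\<close>)
  then show ?thesis using that prv_mkv[OF xc] by blast
qed

text \<open>
  If \<open>S\<close> surjects onto \<open>U\<close>, then it contains \<open>\<epsilon>\<^sub>jU\<close> for every \<open>j\<close>, because \<open>\<epsilon>\<^sub>js\<close> depends only on the
  residue of \<open>s\<close>. Two elements of the graph with the same residue differ by an element of \<open>\<Sum>\<^sub>j \<epsilon>\<^sub>jU\<close>,
  so nothing is missing from \<open>S\<close>.
\<close>

lemma nakayama:
  assumes S: "vec_submodule n S" "S \<subseteq> lift \<theta>" and surj: "U \<subseteq> prv ` S"
  shows "S = lift \<theta>"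
proof
  note SD = vec_submoduleD[OF S(1)]
  show "lift \<theta> \<subseteq> S"
  proof
    fix v assume "v \<in> lift \<theta>"
    note v = liftD[OF this]
    obtain s where s: "s \<in> S" "prv s = prv v" using surj v(2) by force
    note s' = liftD[OF subsetD[OF S(2) s(1)]]
    define y where "y j = Dv j v - Dv j s" for j
    have yU: "y j \<in> U" for j
      using Hom_diff[OF \<theta> v(2) v(3)] s'(3)[of j] s(2) by (simp add: y_def)
    have yc: "y j \<in> carrier_vec n" for j using UD(1)[OF yU] .
    \<comment> \<open>\<open>y j\<close> is the residue of some element of \<open>S\<close>, whose multiple by \<open>\<epsilon>\<^sub>j\<close> is the vector in question.\<close>
    have "eps_vec n j (y j) \<in> S" for j
    proof -
      obtain w where w: "w \<in> S" "y j = prv w" using surj yU by blast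
      show ?thesis using eps_vec_eq_smult[OF SD(1)[OF w(1)], of j] SD(4)[OF w(1)] w(2) by simp
    qed
    then have "mkv n (0\<^sub>v n) y \<in> S" by (rule eps_vecs_mem[OF S(1) yc])
    moreover have "v = s + mkv n (0\<^sub>v n) y"
    proof (rule ext_vec_eqI[OF v(1)])
      show "s + mkv n (0\<^sub>v n) y \<in> carrier_vec n" using s'(1) by simp
      show "prv v = prv (s + mkv n (0\<^sub>v n) y)"
        using v(1) s' by (simp add: prv_add[of _ n] prv_mkv s(2))
      have "Dv j s + (Dv j v - Dv j s) = Dv j v" for j using v(1) s'(1) by (intro eq_vecI) auto
      then show "Dv j v = Dv j (s + mkv n (0\<^sub>v n) y)" for j
        using v(1) s'(1) yc[of j] by (simp add: Dv_add[of _ n] Dv_mkv) (simp add: y_def)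
    qed
    ultimately show "v \<in> S" using SD(3)[OF s(1)] by simp
  qed
qed (fact S(2))

text \<open>
  If \<open>K\<^sup>n = U \<oplus> W\<close>, then the vectors all of whose coordinates lie in \<open>W\<close> are a complement of the graph. A
  common vector has residue in \<open>U \<inter> W = 0\<close>, and therefore infinitesimal coordinates in
  \<open>\<theta>\<^sub>j(0) \<inter> W = U \<inter> W = 0\<close>.
\<close>

lemma lift_direct_summand: "direct_summand n (lift \<theta>)"
proof -
  obtain W where W: "vec_submodule n W" and UW: "U \<inter> W = {0\<^sub>v n}"
    and sum: "{x + y | x y. x \<in> U \<and> y \<in> W} = carrier_vec n"
    using point by (auto simp: Gr_points_def direct_summand_def)
  note WD = vec_submoduleD[OF W]
  have decomp: "\<exists>x w. x \<in> U \<and> w \<in> W \<and> z = x + w" if "z \<in> carrier_vec n" for z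
    using that sum by blast
  define W' where "W' = {v \<in> carrier_vec n. prv v \<in> W \<and> (\<forall>j. Dv j v \<in> W)}"
  have W': "vec_submodule n W'"
    unfolding vec_submodule_iff W'_def
    using WD by (auto simp: prv_add[of _ n] Dv_add[of _ n] prv_smult Dv_smult)
  have trivial: "v \<in> {0\<^sub>v n}" if "v \<in> lift \<theta>" "v \<in> W'" for v
  proof -
    note v = liftD[OF that(1)]
    have "prv v \<in> U \<inter> W" using v(2) that(2) by (simp add: W'_def)
    then have 0: "prv v = 0\<^sub>v n" unfolding UW by simp
    have "Dv j v \<in> U \<inter> W" for j
      using v(3)[of j] that(2) by (simp add: W'_def 0 Hom_zero[OF \<theta>])
    then have "Dv j v = 0\<^sub>v n" for j unfolding UW by simp
    then have "v = 0\<^sub>v n" using v(1) 0 by (intro ext_vec_eqI[of _ n]) simp_all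
    then show ?thesis by simp
  qed
  have "0\<^sub>v n \<in> lift \<theta>" "0\<^sub>v n \<in> W'"
    by (rule vec_submoduleD(2)[OF lift_submodule], rule vec_submoduleD(2)[OF W'])
  then have int: "lift \<theta> \<inter> W' = {0\<^sub>v n}" using trivial by blast
  have split: "\<exists>s w. s \<in> lift \<theta> \<and> w \<in> W' \<and> v = s + w" if v: "v \<in> carrier_vec n" for v
  proof -
    have "prv v \<in> carrier_vec n" using v by simp
    then obtain x w where x: "x \<in> U" "w \<in> W" "prv v = x + w" using decomp by blast
    obtain s where s: "s \<in> lift \<theta>" "prv s = x" using lift_surj[OF x(1)] .
    note s' = liftD[OF s(1)]
    have "\<forall>j. \<exists>u t. u \<in> U \<and> t \<in> W \<and> Dv j v - Dv j s = u + t"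
      using decomp v s'(1) by simp
    then obtain u t where ut: "\<And>j. u j \<in> U" "\<And>j. t j \<in> W" "\<And>j. Dv j v - Dv j s = u j + t j"
      by metis
    have car: "x \<in> carrier_vec n" "w \<in> carrier_vec n" "u j \<in> carrier_vec n" "t j \<in> carrier_vec n"
      "Dv j s \<in> carrier_vec n" "Dv j v \<in> carrier_vec n" for j
      using UD(1) WD(1) x ut s' v by auto
    \<comment> \<open>The parts of the discrepancies that lie in \<open>U\<close> are absorbed into the lift of \<open>x\<close>.\<close>
    define s1 where "s1 = mkv n x (\<lambda>j. Dv j s + u j)"
    have "s1 \<in> lift \<theta>"
      unfolding s1_def
    proof (rule liftI)
      show "Dv j (mkv n x (\<lambda>j. Dv j s + u j)) \<in> \<theta> j (prv (mkv n x (\<lambda>j. Dv j s + u j)))" for j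
        using Hom_shift[OF \<theta> x(1) _ ut(1)] s'(3)[of j] car s(2) by (simp add: prv_mkv Dv_mkv)
    qed (use x car in \<open>auto simp: prv_mkv\<close>)
    moreover have "mkv n w t \<in> W'"
      using x ut car by (simp add: W'_def prv_mkv Dv_mkv)
    moreover have "v = s1 + mkv n w t"
    proof (rule ext_vec_eqI[OF v])
      show "s1 + mkv n w t \<in> carrier_vec n" by (simp add: s1_def)
      show "prv v = prv (s1 + mkv n w t)"
        using car x(3) by (simp add: s1_def prv_add[of _ n] prv_mkv)
      fix j
      have "Dv j v = Dv j s + (Dv j v - Dv j s)" using car(3-6)[of j] by (intro eq_vecI) auto
      also have "\<dots> = (Dv j s + u j) + t j" unfolding ut(3) using car(3-6)[of j] by (intro eq_vecI) auto
      also have "\<dots> = Dv j (s1 + mkv n w t)"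
        using car by (simp add: s1_def Dv_add[of _ n] Dv_mkv)
      finally show "Dv j v = Dv j (s1 + mkv n w t)" .
    qed
    ultimately show ?thesis by blast
  qed
  have "{s + w | s w. s \<in> lift \<theta> \<and> w \<in> W'} = carrier_vec n"
  proof (intro equalityI subsetI)
    show "v \<in> {s + w | s w. s \<in> lift \<theta> \<and> w \<in> W'}" if "v \<in> carrier_vec n" for v
      using split[OF that] by blast
  qed (use vec_submoduleD(1)[OF lift_submodule] vec_submoduleD(1)[OF W'] in auto)
  then show ?thesis unfolding direct_summand_def using lift_submodule W' int by blast
qed

text \<open>
  Lifts \<open>v\<^sub>i\<close> of a basis \<open>u\<^sub>i\<close> of \<open>U\<close> generate the graph by Nakayama. In a relation between them the residues
  of the coefficients form a relation between the \<open>u\<^sub>i\<close>, hence vanish; after that the same holds for each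
  infinitesimal coordinate.
\<close>

lemma lift_has_rank: "has_rank n (lift \<theta>) d"
proof -
  have "has_rank n U d" using point by (simp add: Gr_points_def)
  then obtain u where u: "basis_of n U d u"
    using has_rank_field_imp_basis U_sub UD(1) by (metis subsetI)
  have uU: "u i \<in> U" if "i < d" for i using u that by (simp add: basis_of_def)
  have "\<exists>w. w \<in> lift \<theta> \<and> prv w = u i" if "i < d" for i
    using lift_surj[OF uU[OF that]] by blast
  then obtain v where v: "\<And>i. i < d \<Longrightarrow> v i \<in> lift \<theta>" "\<And>i. i < d \<Longrightarrow> prv (v i) = u i"
    by metis
  let ?comb = "\<lambda>c. vec n (\<lambda>k. \<Sum>i<d. c i * v i $ k)"
  let ?comb' = "\<lambda>c. vec n (\<lambda>k. \<Sum>i<d. c i * u i $ k)"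
  have vn: "dim_vec (v i) = n" if "i < d" for i using liftD(1)[OF v(1)[OF that]] by simp
  have vk: "pr (v i $ k) = u i $ k" if "i < d" "k < n" for i k
    using arg_cong[OF v(2)[OF that(1)], of "\<lambda>x. x $ k"] vn that by simp
  have prv_comb: "prv (?comb c) = ?comb' (\<lambda>i. pr (c i))" for c
    by (intro eq_vecI) (auto simp: pr_sum pr_mult vk intro!: sum.cong)
  have u_indep: "c i = 0" if "?comb' c = 0\<^sub>v n" "i < d" for c i
    using u that unfolding basis_of_def by blast
  have indep: "c i = 0" if c: "?comb c = 0\<^sub>v n" and i: "i < d" for c i
  proof -
    \<comment> \<open>The residue of the relation is a relation between the basis vectors of \<open>U\<close>.\<close>
    have "?comb' (\<lambda>i. pr (c i)) = 0\<^sub>v n" using prv_comb[of c] unfolding c by simp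
    then have pr0: "pr (c i) = 0" if "i < d" for i using u_indep[OF _ that] by fast
    have "D j (c i) = 0" for j
    proof -
      \<comment> \<open>As the coefficients have zero residue, only \<open>D j\<close> of them contributes here.\<close>
      have "?comb' (\<lambda>i. D j (c i)) = Dv j (?comb c)"
        by (intro eq_vecI) (auto simp: D_sum D_mult vk pr0 intro!: sum.cong)
      then have "?comb' (\<lambda>i. D j (c i)) = 0\<^sub>v n" unfolding c by simp
      then show ?thesis using u_indep[OF _ i] by fast
    qed
    then show ?thesis using pr0[OF i] by (intro ext_eqI) auto
  qed
  let ?S = "{?comb c | c. True}"
  have "?comb c \<in> lift \<theta>" for c
  proof -
    have "vec n (\<lambda>k. \<Sum>i<m. c i * v i $ k) \<in> lift \<theta>" if "m \<le> d" for m
      using that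
    proof (induction m)
      case 0
      have "vec n (\<lambda>k. \<Sum>i<0. c i * v i $ k) = 0\<^sub>v n" by (intro eq_vecI) auto
      then show ?case using vec_submoduleD(2)[OF lift_submodule] by simp
    next
      case (Suc m)
      then have "v m \<in> lift \<theta>" using v by simp
      moreover have "vec n (\<lambda>k. \<Sum>i<Suc m. c i * v i $ k) =
          vec n (\<lambda>k. \<Sum>i<m. c i * v i $ k) + c m \<cdot>\<^sub>v v m"
        using vn[of m] Suc.prems by (intro eq_vecI) auto
      ultimately show ?case
        using Suc vec_submoduleD(3,4)[OF lift_submodule] by simp
    qed
    then show ?thesis by simp
  qed
  moreover have "U \<subseteq> prv ` ?S"
  proof
    fix x assume "x \<in> U"
    then obtain c where "x = ?comb' c" using u unfolding basis_of_def by blast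
    also have "\<dots> = prv (?comb (\<lambda>i. mk (c i) (\<lambda>_. 0)))" by (simp add: prv_comb)
    finally have "x = prv (?comb (\<lambda>i. mk (c i) (\<lambda>_. 0)))" .
    moreover have "?comb c \<in> ?S" for c by blast
    ultimately show "x \<in> prv ` ?S" by (rule image_eqI)
  qed
  ultimately have "?S = lift \<theta>" by (intro nakayama combinations_submodule) blast+
  then have "\<exists>c. x = ?comb c" if "x \<in> lift \<theta>" for x using that by blast
  then have "basis_of n (lift \<theta>) d v"
    unfolding basis_of_def using v(1) indep by blast
  then show ?thesis
    using basis_of_imp_has_rank[of "lift \<theta>"] liftD(1) by blast
qed

lemma lift_point: "lift \<theta> \<in> Gr_points \<Lambda> d n M \<phi>"
  by (simp add: Gr_points_def lift_tensor_submodule lift_direct_summand lift_has_rank)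

lemma prv_lift: "prv ` lift \<theta> = U"
proof
  show "U \<subseteq> prv ` lift \<theta>" using lift_surj by (metis image_eqI subsetI)
qed (use liftD(2) in blast)

text \<open>
  The span of the image of \<open>V\<close> is a submodule of the graph that surjects onto \<open>U\<close>, so Nakayama makes the
  inclusion an equality. All effects of ring homomorphisms on points over \<open>U\<close> are computed in
  this way.
\<close>

lemma Gr_map_eq_lift:
  assumes "\<And>v. v \<in> V \<Longrightarrow> map_vec \<psi> v \<in> lift \<theta>"
    and "\<And>x. x \<in> U \<Longrightarrow> \<exists>v\<in>V. prv (map_vec \<psi> v) = x"
  shows "Gr_map n \<psi> V = lift \<theta>"
  unfolding Gr_map_def
proof (rule span_eq)
  show "map_vec \<psi> ` V \<subseteq> lift \<theta>" using assms(1) by blast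
  fix W assume W: "vec_submodule n W" "map_vec \<psi> ` V \<subseteq> W" "W \<subseteq> lift \<theta>"
  have "U \<subseteq> prv ` W" using assms(2) W(2) by force
  then show "W = lift \<theta>" using nakayama W by blast
qed (rule lift_submodule)

lemma Gr_map_pr_lift: "Gr_map n pr (lift \<theta>) = U"
  unfolding Gr_map_def prv_lift by (rule span_eq) (use U_sub in auto)

end

text \<open>
  A given \<open>y \<in> \<theta>\<^sub>j(x)\<close> is completed to a vector of the graph by arbitrary choices for the other
  infinitesimals, and then read off in the other graph.
\<close>

lemma lift_inj:
  assumes \<theta>: "\<And>j. \<theta> j \<in> Hom" and \<theta>': "\<And>j. \<theta>' j \<in> Hom" and eq: "lift \<theta> = lift \<theta>'"
  shows "\<theta> j = \<theta>' j"
proof (rule Hom_eqI[OF \<theta> \<theta>'])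
  fix x assume x: "x \<in> U"
  show "\<theta> j x \<subseteq> \<theta>' j x"
  proof
    fix y assume y: "y \<in> \<theta> j x"
    obtain z where z: "\<And>i. z i \<in> \<theta> i x" using Hom_nonempty[OF \<theta> x] by metis
    \<comment> \<open>Only the \<open>j\<close>-th coordinate is prescribed.\<close>
    define w where "w = z(j := y)"
    have w: "w i \<in> \<theta> i x" for i using y z by (simp add: w_def)
    have car: "x \<in> carrier_vec n" "w i \<in> carrier_vec n" for i
      using UD(1)[OF x] Hom_closed[OF \<theta> x w] by auto
    have "mkv n x w \<in> lift \<theta>" using x w car by (intro liftI) (auto simp: prv_mkv Dv_mkv)
    then have "mkv n x w \<in> lift \<theta>'" using eq by simp
    from liftD(3)[OF this, of j] have "w j \<in> \<theta>' j x"
      unfolding Dv_mkv[OF car(2)] prv_mkv[OF car(1)] .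
    then show "y \<in> \<theta>' j x" by (simp add: w_def)
  qed
qed

text \<open>
  The scalars of \<open>K\<close> are lifted to constants.
\<close>

lemma prv_image_submodule:
  assumes V: "vec_submodule n V"
  shows "vec_submodule n (prv ` V)"
  unfolding vec_submodule_iff
proof (intro conjI ballI allI)
  note VD = vec_submoduleD[OF V]
  show "prv ` V \<subseteq> carrier_vec n" using VD(1) by auto
  show "0\<^sub>v n \<in> prv ` V" using VD(2) by (intro image_eqI[of _ _ "0\<^sub>v n"]) auto
  fix x assume "x \<in> prv ` V"
  then obtain v where v: "v \<in> V" "x = prv v" by auto
  show "c \<cdot>\<^sub>v x \<in> prv ` V" for c
    using VD(4)[OF v(1), of "mk c (\<lambda>_. 0)"] v(2)
    by (intro image_eqI[of _ _ "mk c (\<lambda>_. 0) \<cdot>\<^sub>v v"]) (auto simp: prv_smult)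
  fix y assume "y \<in> prv ` V"
  then obtain w where w: "w \<in> V" "y = prv w" by auto
  show "x + y \<in> prv ` V"
    using v w VD(3)[OF v(1) w(1)] prv_add[OF VD(1)[OF v(1)] VD(1)[OF w(1)]]
    by (intro image_eqI[of _ _ "v + w"]) auto
qed

lemma prv_preimage_submodule:
  assumes S: "vec_submodule n S"
  shows "vec_submodule n {v \<in> carrier_vec n. prv v \<in> S}"
  unfolding vec_submodule_iff using vec_submoduleD[OF S]
  by (auto simp: prv_add[of _ n] prv_smult)

lemma Gr_map_pr_eq_image:
  assumes V: "vec_submodule n V"
  shows "Gr_map n pr V = prv ` V"
  unfolding Gr_map_def by (rule span_eq) (use prv_image_submodule[OF V] in auto)

text \<open>
  Let \<open>z = \<Sum>\<^sub>j \<epsilon>\<^sub>jz\<^sub>j\<close> lie in the summand \<open>V\<close>, and split each constant vector as \<open>z\<^sub>j = v\<^sub>j + w\<^sub>j\<close> with \<open>v\<^sub>j \<in> V\<close> and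
  \<open>w\<^sub>j\<close> in the complement \<open>W\<close>. Then \<open>\<Sum>\<^sub>j \<epsilon>\<^sub>jw\<^sub>j = z - \<Sum>\<^sub>j \<epsilon>\<^sub>jv\<^sub>j\<close> lies in \<open>V \<inter> W = 0\<close>, so the residue of \<open>w\<^sub>j\<close> is zero and \<open>z\<^sub>j\<close>
  is the residue of \<open>v\<^sub>j\<close>.
\<close>

lemma summand_eps_components:
  assumes V: "direct_summand n V" and z: "z \<in> V" "prv z = 0\<^sub>v n"
  shows "Dv j z \<in> prv ` V"
proof -
  obtain W where W: "vec_submodule n W" and VW: "V \<inter> W = {0\<^sub>v n}"
    and sum: "{x + y | x y. x \<in> V \<and> y \<in> W} = carrier_vec n"
    and V': "vec_submodule n V"
    using V by (auto simp: direct_summand_def)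
  note VD = vec_submoduleD[OF V'] and WD = vec_submoduleD[OF W]
  have "\<forall>j. \<exists>v w. v \<in> V \<and> w \<in> W \<and> mkv n (Dv j z) (\<lambda>_. 0\<^sub>v n) = v + w"
    using sum mkv_closed by blast
  then obtain v w where vw: "\<And>j. v j \<in> V" "\<And>j. w j \<in> W"
    "\<And>j. mkv n (Dv j z) (\<lambda>_. 0\<^sub>v n) = v j + w j" by metis
  have car: "z \<in> carrier_vec n" "v j \<in> carrier_vec n" "w j \<in> carrier_vec n" for j
    using z vw VD(1) WD(1) by auto
  have Dz: "Dv j z = prv (v j) + prv (w j)" for j
    using arg_cong[OF vw(3)[of j], of prv] car by (simp add: prv_mkv prv_add[of _ n])
  define a b where "a = mkv n (0\<^sub>v n) (\<lambda>j. prv (v j))" and "b = mkv n (0\<^sub>v n) (\<lambda>j. prv (w j))"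
  have "a \<in> V"
    unfolding a_def
    by (rule eps_vecs_mem[OF V']) (use car VD(4)[OF vw(1)] in \<open>auto simp: eps_vec_eq_smult\<close>)
  have "b \<in> W"
    unfolding b_def
    by (rule eps_vecs_mem[OF W]) (use car WD(4)[OF vw(2)] in \<open>auto simp: eps_vec_eq_smult\<close>)
  have "b = z - a"
  proof (rule ext_vec_eqI[of _ n])
    show "Dv i b = Dv i (z - a)" for i
      using car(1) car(2,3)[of i] by (auto simp: a_def b_def Dv_diff[of _ n] Dv_mkv Dz)
  qed (use car z(2) in \<open>auto simp: a_def b_def prv_diff[of _ n] prv_mkv\<close>)
  then have "b \<in> V" using VD(5)[OF z(1) \<open>a \<in> V\<close>] by simp
  then have "b = 0\<^sub>v n" using VW \<open>b \<in> W\<close> by blast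
  then have "Dv j b = 0\<^sub>v n" by simp
  then have "prv (w j) = 0\<^sub>v n" using car by (simp add: b_def Dv_mkv)
  then show ?thesis using Dz[of j] vw(1)[of j] car(2,3)[of j] by simp
qed

text \<open>
  The homomorphisms are read off from \<open>V\<close> as \<open>\<theta>\<^sub>j(x) = {D\<^sub>j v. v \<in> V, v \<mapsto> x}\<close>. Each value is a full
  coset of \<open>U\<close>: the difference of two lifts of \<open>x\<close> has its infinitesimal coordinates in \<open>U\<close> because \<open>V\<close> is a direct
  summand, and conversely \<open>\<epsilon>\<^sub>jU \<subseteq> V\<close>. By construction \<open>V\<close> lies in the graph of \<open>\<theta>\<close>, and Nakayama
  gives equality.
\<close>

lemma lift_surj_on_points:
  assumes V: "V \<in> Gr_points \<Lambda> d n M \<phi>" and over: "Gr_map n pr V = U"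
  obtains \<theta> where "\<And>j. \<theta> j \<in> Hom" "V = lift \<theta>"
proof -
  have VS: "vec_submodule n V" and stable: "\<And>l v. \<lbrakk>l \<in> carrier \<Lambda>; v \<in> V\<rbrakk> \<Longrightarrow> map_mat \<phi> (M l) *\<^sub>v v \<in> V"
    and summand: "direct_summand n V"
    using V tensor_submodule_ext_iff[of V] by (auto simp: Gr_points_def)
  note VD = vec_submoduleD[OF VS]
  have im: "prv ` V = U" using over Gr_map_pr_eq_image[OF VS] by simp
  define \<theta> where "\<theta> j = (\<lambda>x\<in>U. {Dv j v | v. v \<in> V \<and> prv v = x})" for j
  have \<theta>: "\<theta> j x = {Dv j v | v. v \<in> V \<and> prv v = x}" if "x \<in> U" for j x
    using that by (simp add: \<theta>_def)
  have Hom: "\<theta> j \<in> Hom" for j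
    unfolding Hom_iff
  proof (intro conjI ballI allI)
    show "\<theta> j \<in> extensional U" by (simp add: \<theta>_def)
  next
    fix x assume x: "x \<in> U"
    then obtain v where v: "v \<in> V" "prv v = x" using im by blast
    have "\<theta> j x = (\<lambda>u. u + Dv j v) ` U"
      unfolding \<theta>[OF x]
    proof safe
      fix w assume w: "w \<in> V" "x = prv w"
      have "prv (w - v) = 0\<^sub>v n"
        using v w VD(1) by (auto simp: prv_diff[of _ n])
      then have "Dv j (w - v) \<in> U" using summand_eps_components[OF summand VD(5)[OF w(1) v(1)]] im by blast
      moreover have "Dv j w = Dv j (w - v) + Dv j v"
        using VD(1)[OF v(1)] VD(1)[OF w(1)] by (auto simp: Dv_diff[of _ n] intro!: eq_vecI)
      ultimately show "Dv j w \<in> (\<lambda>u. u + Dv j v) ` U" by blast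
    next
      fix u assume "u \<in> U"
      then obtain w where w: "w \<in> V" "prv w = u" using im by blast
      let ?v = "eps_vec n j u + v"
      have "?v \<in> V"
        using VD(3)[OF VD(4)[OF w(1)] v(1)] eps_vec_eq_smult[OF VD(1)[OF w(1)], of j] w(2) by simp
      moreover have "prv ?v = x" using VD(1)[OF v(1)] v(2) by (auto simp: prv_add[of _ n])
      moreover have "Dv j ?v = u + Dv j v"
        using VD(1)[OF v(1)] UD(1)[OF \<open>u \<in> U\<close>] by (simp add: Dv_add[of _ n] Dv_eps_vec)
      ultimately show "\<exists>w. u + Dv j v = Dv j w \<and> w \<in> V \<and> prv w = x" by metis
    qed
    then show "\<exists>y\<in>carrier_vec n. \<theta> j x = (\<lambda>u. u + y) ` U"
      using VD(1)[OF v(1)] by (intro bexI[of _ "Dv j v"]) auto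
    fix y assume "y \<in> \<theta> j x"
    then obtain v where v: "v \<in> V" "prv v = x" "y = Dv j v" unfolding \<theta>[OF x] by blast
    have vc: "v \<in> carrier_vec n" using VD(1)[OF v(1)] .
    show "c \<cdot>\<^sub>v y \<in> \<theta> j (c \<cdot>\<^sub>v x)" for c
    proof -
      let ?w = "mk c (\<lambda>_. 0) \<cdot>\<^sub>v v"
      have "?w \<in> V" "prv ?w = c \<cdot>\<^sub>v x" using VD(4)[OF v(1)] v(2) by (auto simp: prv_smult)
      moreover have "Dv j ?w = c \<cdot>\<^sub>v y" using vc v(3) by (auto simp: Dv_smult intro!: eq_vecI)
      ultimately show ?thesis unfolding \<theta>[OF UD(4)[OF x]] by (auto intro!: exI[of _ ?w])
    qed
    show "act l y \<in> \<theta> j (act l x)" if l: "l \<in> carrier \<Lambda>" for l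
      unfolding \<theta>[OF act_U[OF l x]]
      using stable[OF l v(1)] prv_act[OF l vc] Dv_act[OF l vc, of j] v(2,3) by force
    fix x' y' assume x': "x' \<in> U" and "y' \<in> \<theta> j x'"
    then obtain v' where v': "v' \<in> V" "prv v' = x'" "y' = Dv j v'" unfolding \<theta>[OF x'] by blast
    show "y + y' \<in> \<theta> j (x + x')"
      unfolding \<theta>[OF UD(3)[OF x x']]
      using VD(3)[OF v(1) v'(1)] prv_add[OF vc VD(1)[OF v'(1)]] Dv_add[OF vc VD(1)[OF v'(1)], of j] v v'
      by (intro CollectI exI[of _ "v + v'"]) simp
  qed
  have "V \<subseteq> lift \<theta>"
    using im VD(1) by (auto simp: lift_def \<theta>)
  then have "V = lift \<theta>" using nakayama[OF Hom VS] im by simp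
  with Hom show ?thesis using that by blast
qed

end


section \<open>The tangent space as a space of graphs\<close>

lemma dual_square_zero:
  "square_zero_extension (std :: 'K::comm_ring_1 dual \<Rightarrow> 'K) (\<lambda>_::unit. eps) (\<lambda>a b. Dual a (b ()))"
  by unfold_locales (auto simp: plus_dual_def times_dual_def one_dual_def)

lemma dual2_square_zero:
  "square_zero_extension (std2 :: 'K::comm_ring_1 dual2 \<Rightarrow> 'K) (\<lambda>b. if b then eps1 else eps2)
     (\<lambda>a b. Dual2 a (b True) (b False))"
  by unfold_locales (auto simp: plus_dual2_def times_dual2_def one_dual2_def)

context grassmannian_point
begin

interpretation dual: deformation \<Lambda> n M d \<iota> U std "\<lambda>_::unit. eps" "\<lambda>a b. Dual a (b ())"
  by (intro deformation.intro grassmannian_point_axioms dual_square_zero)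

interpretation dual2: deformation \<Lambda> n M d \<iota> U std2 "\<lambda>b. if b then eps1 else eps2"
    "\<lambda>a b. Dual2 a (b True) (b False)"
  by (intro deformation.intro grassmannian_point_axioms dual2_square_zero)

definition graph :: "('K vec \<Rightarrow> 'K vec set) \<Rightarrow> 'K dual vec set" where
  "graph \<theta> = {v \<in> carrier_vec n. map_vec std v \<in> U \<and> map_vec eps v \<in> \<theta> (map_vec std v)}"

definition graph2 :: "('K vec \<Rightarrow> 'K vec set) \<Rightarrow> ('K vec \<Rightarrow> 'K vec set) \<Rightarrow> 'K dual2 vec set" where
  "graph2 \<theta>\<^sub>1 \<theta>\<^sub>2 = {v \<in> carrier_vec n. map_vec std2 v \<in> U \<and>
     map_vec eps1 v \<in> \<theta>\<^sub>1 (map_vec std2 v) \<and> map_vec eps2 v \<in> \<theta>\<^sub>2 (map_vec std2 v)}"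

lemma graph_eq_lift: "graph \<theta> = dual.lift (\<lambda>_. \<theta>)"
  by (auto simp: graph_def dual.lift_def)

lemma graph2_eq_lift: "graph2 \<theta>\<^sub>1 \<theta>\<^sub>2 = dual2.lift (\<lambda>b. if b then \<theta>\<^sub>1 else \<theta>\<^sub>2)"
  by (auto simp: graph2_def dual2.lift_def split: if_splits)

lemma dual_structure_map: "dual.\<phi> = dual_const \<circ> \<iota>" and dual2_structure_map: "dual2.\<phi> = dual2_const \<circ> \<iota>"
  by (auto simp: dual_const_def dual2_const_def)

lemma tangent_space_carrier:
  "carrier (tangent_space \<Lambda> d n M \<iota> U) = graph ` Hom"
proof (intro equalityI subsetI)
  fix V assume "V \<in> carrier (tangent_space \<Lambda> d n M \<iota> U)"
  then have "V \<in> Gr_points \<Lambda> d n M dual.\<phi>" "Gr_map n std V = U"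
    by (auto simp: tangent_space_def dual_structure_map)
  then obtain \<theta> where \<theta>: "\<And>j. \<theta> j \<in> Hom" "V = dual.lift \<theta>"
    using dual.lift_surj_on_points by blast
  have "V = graph (\<theta> ())" unfolding \<theta>(2) graph_eq_lift by simp
  then show "V \<in> graph ` Hom" using \<theta>(1) by blast
next
  fix V assume "V \<in> graph ` Hom"
  then obtain \<theta> where "\<theta> \<in> Hom" "V = graph \<theta>" by blast
  then show "V \<in> carrier (tangent_space \<Lambda> d n M \<iota> U)"
    using dual.lift_point[of "\<lambda>_. \<theta>"] dual.Gr_map_pr_lift[of "\<lambda>_. \<theta>"]
    by (simp add: tangent_space_def graph_eq_lift dual_structure_map)
qed

lemma graph_inj: "inj_on graph Hom"
proof (rule inj_onI)
  fix \<theta> \<theta>' assume "\<theta> \<in> Hom" "\<theta>' \<in> Hom" "graph \<theta> = graph \<theta>'"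
  then show "\<theta> = \<theta>'"
    using dual.lift_inj[of "\<lambda>_. \<theta>" "\<lambda>_. \<theta>'" "()"] by (simp add: graph_eq_lift)
qed

lemma Gr_map_eq_graph:
  assumes "\<theta> \<in> Hom"
    and "\<And>v. v \<in> V \<Longrightarrow> map_vec \<psi> v \<in> graph \<theta>"
    and "\<And>x. x \<in> U \<Longrightarrow> \<exists>v\<in>V. map_vec std (map_vec \<psi> v) = x"
  shows "Gr_map n \<psi> V = graph \<theta>"
  using dual.Gr_map_eq_lift[of "\<lambda>_. \<theta>" V \<psi>] assms by (simp add: graph_eq_lift)

lemma graph_surj:
  assumes "\<theta> \<in> Hom" "x \<in> U"
  shows "\<exists>v\<in>graph \<theta>. map_vec std v = x"
  using dual.lift_surj[of "\<lambda>_. \<theta>" x] assms unfolding graph_eq_lift by blast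

lemma graph2_surj:
  assumes "\<theta>\<^sub>1 \<in> Hom" "\<theta>\<^sub>2 \<in> Hom" "x \<in> U"
  shows "\<exists>v\<in>graph2 \<theta>\<^sub>1 \<theta>\<^sub>2. map_vec std2 v = x"
proof -
  have "(if b then \<theta>\<^sub>1 else \<theta>\<^sub>2) \<in> Hom" for b using assms(1,2) by simp
  then obtain v where "v \<in> dual2.lift (\<lambda>b. if b then \<theta>\<^sub>1 else \<theta>\<^sub>2)" "map_vec std2 v = x"
    using dual2.lift_surj[OF _ assms(3), of "\<lambda>b. if b then \<theta>\<^sub>1 else \<theta>\<^sub>2"] by blast
  then show ?thesis by (auto simp: graph2_eq_lift)
qed

lemma Hom_module: "Module.module class_ring (hom_to_quotient \<Lambda> n M \<iota> U)"
  by (rule hom_to_quotient_is_module[of \<iota>, OF \<iota>_zero \<iota>_one tensor_sub])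

lemma Hom_zero_mem: "\<zero>\<^bsub>hom_to_quotient \<Lambda> n M \<iota> U\<^esub> \<in> Hom"
  and Hom_add_mem: "\<lbrakk>\<theta>\<^sub>1 \<in> Hom; \<theta>\<^sub>2 \<in> Hom\<rbrakk> \<Longrightarrow> \<theta>\<^sub>1 \<oplus>\<^bsub>hom_to_quotient \<Lambda> n M \<iota> U\<^esub> \<theta>\<^sub>2 \<in> Hom"
  and Hom_smult_mem: "\<theta>\<^sub>1 \<in> Hom \<Longrightarrow> c \<odot>\<^bsub>hom_to_quotient \<Lambda> n M \<iota> U\<^esub> \<theta>\<^sub>1 \<in> Hom"
proof -
  interpret H: Module.module class_ring "hom_to_quotient \<Lambda> n M \<iota> U" by (rule Hom_module)
  show "\<zero>\<^bsub>hom_to_quotient \<Lambda> n M \<iota> U\<^esub> \<in> Hom" by simp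
  show "\<theta>\<^sub>1 \<oplus>\<^bsub>hom_to_quotient \<Lambda> n M \<iota> U\<^esub> \<theta>\<^sub>2 \<in> Hom" if "\<theta>\<^sub>1 \<in> Hom" "\<theta>\<^sub>2 \<in> Hom"
    using that by simp
  show "c \<odot>\<^bsub>hom_to_quotient \<Lambda> n M \<iota> U\<^esub> \<theta>\<^sub>1 \<in> Hom" if "\<theta>\<^sub>1 \<in> Hom"
    using H.smult_closed[of c] that by simp
qed

lemma Hom_zero_value: "x \<in> U \<Longrightarrow> \<zero>\<^bsub>hom_to_quotient \<Lambda> n M \<iota> U\<^esub> x = U"
  by (simp add: hom_to_quotient_def Let_def tensor_hom_def quotient_module_def)

lemma Hom_add_value:
  assumes "x \<in> U" "y\<^sub>1 \<in> \<theta>\<^sub>1 x" "y\<^sub>2 \<in> \<theta>\<^sub>2 x"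
  shows "y\<^sub>1 + y\<^sub>2 \<in> (\<theta>\<^sub>1 \<oplus>\<^bsub>hom_to_quotient \<Lambda> n M \<iota> U\<^esub> \<theta>\<^sub>2) x"
  using assms
  by (auto simp: hom_to_quotient_def Let_def tensor_hom_def quotient_module_def set_add_def set_mult_def
      module_vec_simps)

lemma Hom_smult_value:
  assumes "\<theta> \<in> Hom" "x \<in> U" "y \<in> \<theta> x"
  shows "c \<cdot>\<^sub>v y \<in> (c \<odot>\<^bsub>hom_to_quotient \<Lambda> n M \<iota> U\<^esub> \<theta>) x"
proof -
  have "c \<cdot>\<^sub>v y \<in> (\<lambda>u. u + c \<cdot>\<^sub>v y) ` U"
    using self_in_coset[OF U_sub] Hom_closed[OF assms] by simp
  then show ?thesis
    using assms
    by (auto simp: hom_to_quotient_def Let_def tensor_hom_def quotient_module_def quotient_map_def coset_vec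
        module_vec_simps)
qed

lemma graph_zero:
  "graph \<zero>\<^bsub>hom_to_quotient \<Lambda> n M \<iota> U\<^esub> = Gr_map n dual_const U"
proof (rule Gr_map_eq_graph[symmetric, OF Hom_zero_mem])
  fix x assume x: "x \<in> U"
  have "map_vec std (map_vec dual_const x) = x"
    by (intro eq_vecI) (auto simp: dual_const_def)
  moreover have "map_vec eps (map_vec dual_const x) = 0\<^sub>v n"
    using UD(1)[OF x] by (intro eq_vecI) (auto simp: dual_const_def)
  ultimately show "map_vec dual_const x \<in> graph \<zero>\<^bsub>hom_to_quotient \<Lambda> n M \<iota> U\<^esub>"
    and "\<exists>v\<in>U. map_vec std (map_vec dual_const v) = x"
    using x UD(1)[OF x] UD(2) Hom_zero_value[OF x] by (auto simp: graph_def)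
qed

text \<open>
  For \<open>c = 0\<close> the image of the graph under \<open>\<epsilon> \<mapsto> c\<epsilon>\<close> is only the set of constant vectors \<open>x\<close> with \<open>x \<in> U\<close>; the part \<open>\<epsilon>U\<close> appears only in its span.
\<close>

lemma graph_smult:
  assumes "\<theta> \<in> Hom"
  shows "graph (c \<odot>\<^bsub>hom_to_quotient \<Lambda> n M \<iota> U\<^esub> \<theta>) = Gr_map n (dual_scale c) (graph \<theta>)"
proof (rule Gr_map_eq_graph[symmetric, OF Hom_smult_mem[OF assms]])
  have std: "map_vec std (map_vec (dual_scale c) v) = map_vec std v"
    and eps: "map_vec eps (map_vec (dual_scale c) v) = c \<cdot>\<^sub>v map_vec eps v" for v
    by (auto simp: dual_scale_def intro!: eq_vecI)
  show "map_vec (dual_scale c) v \<in> graph (c \<odot>\<^bsub>hom_to_quotient \<Lambda> n M \<iota> U\<^esub> \<theta>)" if "v \<in> graph \<theta>" for v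
    using that Hom_smult_value[OF assms] by (auto simp: graph_def std eps)
  show "\<exists>v\<in>graph \<theta>. map_vec std (map_vec (dual_scale c) v) = x" if "x \<in> U" for x
    using graph_surj[OF assms that] by (simp add: std)
qed

lemma graph2_fst:
  assumes "\<theta>\<^sub>1 \<in> Hom" "\<theta>\<^sub>2 \<in> Hom"
  shows "Gr_map n dual2_fst (graph2 \<theta>\<^sub>1 \<theta>\<^sub>2) = graph \<theta>\<^sub>1"
proof (rule Gr_map_eq_graph[OF assms(1)])
  have std: "map_vec std (map_vec dual2_fst v) = map_vec std2 v"
    and eps: "map_vec eps (map_vec dual2_fst v) = map_vec eps1 v" for v
    by (auto simp: dual2_fst_def intro!: eq_vecI)
  show "map_vec dual2_fst v \<in> graph \<theta>\<^sub>1" if "v \<in> graph2 \<theta>\<^sub>1 \<theta>\<^sub>2" for v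
    using that by (auto simp: graph_def graph2_def std eps)
  show "\<exists>v\<in>graph2 \<theta>\<^sub>1 \<theta>\<^sub>2. map_vec std (map_vec dual2_fst v) = x" if "x \<in> U" for x
    using graph2_surj[OF assms that] by (simp add: std)
qed

lemma graph2_snd:
  assumes "\<theta>\<^sub>1 \<in> Hom" "\<theta>\<^sub>2 \<in> Hom"
  shows "Gr_map n dual2_snd (graph2 \<theta>\<^sub>1 \<theta>\<^sub>2) = graph \<theta>\<^sub>2"
proof (rule Gr_map_eq_graph[OF assms(2)])
  have std: "map_vec std (map_vec dual2_snd v) = map_vec std2 v"
    and eps: "map_vec eps (map_vec dual2_snd v) = map_vec eps2 v" for v
    by (auto simp: dual2_snd_def intro!: eq_vecI)
  show "map_vec dual2_snd v \<in> graph \<theta>\<^sub>2" if "v \<in> graph2 \<theta>\<^sub>1 \<theta>\<^sub>2" for v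
    using that by (auto simp: graph_def graph2_def std eps)
  show "\<exists>v\<in>graph2 \<theta>\<^sub>1 \<theta>\<^sub>2. map_vec std (map_vec dual2_snd v) = x" if "x \<in> U" for x
    using graph2_surj[OF assms that] by (simp add: std)
qed

lemma graph2_sum:
  assumes "\<theta>\<^sub>1 \<in> Hom" "\<theta>\<^sub>2 \<in> Hom"
  shows "Gr_map n dual2_sum (graph2 \<theta>\<^sub>1 \<theta>\<^sub>2) = graph (\<theta>\<^sub>1 \<oplus>\<^bsub>hom_to_quotient \<Lambda> n M \<iota> U\<^esub> \<theta>\<^sub>2)"
proof (rule Gr_map_eq_graph[OF Hom_add_mem[OF assms]])
  have std: "map_vec std (map_vec dual2_sum v) = map_vec std2 v"
    and eps: "map_vec eps (map_vec dual2_sum v) = map_vec eps1 v + map_vec eps2 v" for v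
    by (auto simp: dual2_sum_def intro!: eq_vecI)
  show "map_vec dual2_sum v \<in> graph (\<theta>\<^sub>1 \<oplus>\<^bsub>hom_to_quotient \<Lambda> n M \<iota> U\<^esub> \<theta>\<^sub>2)" if "v \<in> graph2 \<theta>\<^sub>1 \<theta>\<^sub>2" for v
    using that Hom_add_value by (auto simp: graph_def graph2_def std eps)
  show "\<exists>v\<in>graph2 \<theta>\<^sub>1 \<theta>\<^sub>2. map_vec std (map_vec dual2_sum v) = x" if "x \<in> U" for x
    using graph2_surj[OF assms that] by (simp add: std)
qed

text \<open>
  The two projections force every element of \<open>W\<close> into the common graph, and \<open>W\<close> surjects onto \<open>U\<close>
  because its first projection does. Nakayama then leaves only one possibility.
\<close>

lemma graph2_unique:
  assumes \<theta>: "\<theta>\<^sub>1 \<in> Hom" "\<theta>\<^sub>2 \<in> Hom" and W: "W \<in> Gr_points \<Lambda> d n M (dual2_const \<circ> \<iota>)"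
    and fst: "Gr_map n dual2_fst W = graph \<theta>\<^sub>1" and snd: "Gr_map n dual2_snd W = graph \<theta>\<^sub>2"
  shows "W = graph2 \<theta>\<^sub>1 \<theta>\<^sub>2"
proof -
  have W_sub: "vec_submodule n W"
    using W dual2.tensor_submodule_ext_iff[of W]
    by (simp add: Gr_points_def dual2_structure_map)
  note WD = vec_submoduleD[OF W_sub]
  have Wc: "W \<subseteq> carrier_vec n" using WD(1) by blast
  have sub: "W \<subseteq> graph2 \<theta>\<^sub>1 \<theta>\<^sub>2"
  proof
    fix w assume w: "w \<in> W"
    have coords: "map_vec std (map_vec dual2_fst w) = map_vec std2 w" "map_vec std (map_vec dual2_snd w) = map_vec std2 w"
      "map_vec eps (map_vec dual2_fst w) = map_vec eps1 w" "map_vec eps (map_vec dual2_snd w) = map_vec eps2 w"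
      by (auto simp: dual2_fst_def dual2_snd_def intro!: eq_vecI)
    have "map_vec dual2_fst w \<in> graph \<theta>\<^sub>1" "map_vec dual2_snd w \<in> graph \<theta>\<^sub>2"
      using Gr_map_superset[OF Wc, of dual2_fst] Gr_map_superset[OF Wc, of dual2_snd] w fst snd by auto
    then show "w \<in> graph2 \<theta>\<^sub>1 \<theta>\<^sub>2" by (simp add: graph_def graph2_def coords)
  qed
  \<comment> \<open>The vectors whose residue comes from \<open>W\<close> form a submodule, so they include the span of the first projection.\<close>
  have "graph \<theta>\<^sub>1 \<subseteq> {v \<in> carrier_vec n. map_vec std v \<in> map_vec std2 ` W}"
    unfolding fst[symmetric]
  proof (intro Gr_map_subset dual.prv_preimage_submodule dual2.prv_image_submodule W_sub)
    have "map_vec std (map_vec dual2_fst w) = map_vec std2 w" for w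
      by (auto simp: dual2_fst_def intro!: eq_vecI)
    then show "map_vec dual2_fst ` W \<subseteq> {v \<in> carrier_vec n. map_vec std v \<in> map_vec std2 ` W}"
      using WD(1) by auto
  qed
  then have "U \<subseteq> map_vec std2 ` W" using graph_surj[OF \<theta>(1)] by blast
  then show ?thesis
    using dual2.nakayama[of "\<lambda>b. if b then \<theta>\<^sub>1 else \<theta>\<^sub>2" W] W_sub sub \<theta> by (simp add: graph2_eq_lift)
qed

lemma graph_add:
  assumes "\<theta>\<^sub>1 \<in> Hom" "\<theta>\<^sub>2 \<in> Hom"
  shows "graph (\<theta>\<^sub>1 \<oplus>\<^bsub>hom_to_quotient \<Lambda> n M \<iota> U\<^esub> \<theta>\<^sub>2) =
    graph \<theta>\<^sub>1 \<oplus>\<^bsub>tangent_space \<Lambda> d n M \<iota> U\<^esub> graph \<theta>\<^sub>2"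
proof -
  have "(if b then \<theta>\<^sub>1 else \<theta>\<^sub>2) \<in> Hom" for b using assms by simp
  then have "graph2 \<theta>\<^sub>1 \<theta>\<^sub>2 \<in> Gr_points \<Lambda> d n M (dual2_const \<circ> \<iota>)"
    unfolding graph2_eq_lift dual2_structure_map[symmetric] by (rule dual2.lift_point)
  then have "(THE W. W \<in> Gr_points \<Lambda> d n M (dual2_const \<circ> \<iota>) \<and>
      Gr_map n dual2_fst W = graph \<theta>\<^sub>1 \<and> Gr_map n dual2_snd W = graph \<theta>\<^sub>2) = graph2 \<theta>\<^sub>1 \<theta>\<^sub>2"
    using graph2_fst[OF assms] graph2_snd[OF assms]
    by (intro the_equality conjI) (simp_all, elim conjE, rule graph2_unique[OF assms])
  then show ?thesis using graph2_sum[OF assms] by (simp add: tangent_space_def)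
qed

lemma tangent_space_iso:
  "vector_space_iso (tangent_space \<Lambda> d n M \<iota> U) (hom_to_quotient \<Lambda> n M \<iota> U)"
proof (rule vector_space_iso_transport[of _ graph])
  show "bij_betw graph Hom (carrier (tangent_space \<Lambda> d n M \<iota> U))"
    using graph_inj tangent_space_carrier by (simp add: bij_betw_def)
  show "graph \<zero>\<^bsub>hom_to_quotient \<Lambda> n M \<iota> U\<^esub> = \<zero>\<^bsub>tangent_space \<Lambda> d n M \<iota> U\<^esub>"
    by (simp add: graph_zero tangent_space_def)
  show "graph (c \<odot>\<^bsub>hom_to_quotient \<Lambda> n M \<iota> U\<^esub> \<theta>) = c \<odot>\<^bsub>tangent_space \<Lambda> d n M \<iota> U\<^esub> graph \<theta>"
    if "\<theta> \<in> Hom" for c \<theta>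
    using graph_smult[OF that] by (simp add: tangent_space_def)
qed (fact Hom_module graph_add)+

end

theorem lemma2p1:
  fixes d e :: nat
    and \<Lambda> :: "('k::field, 'l) module"
    and M :: "'l \<Rightarrow> 'k mat"
    and \<iota> :: "'k \<Rightarrow> 'K::field"
    and U :: "'K vec set"
  assumes "finitely_generated_algebra \<Lambda>"
    and "M \<in> Mod_points \<Lambda> (d + e)"
    and "field_hom \<iota>"
    and "U \<in> Gr_points \<Lambda> d (d + e) M \<iota>"
  shows "vector_space_iso (tangent_space \<Lambda> d (d + e) M \<iota> U) (hom_to_quotient \<Lambda> (d + e) M \<iota> U)"
proof -
  interpret field_hom \<iota> by (rule assms(3))
  interpret module_structure \<Lambda> "d + e" M by (rule module_structureI[OF assms(1,2)])
  interpret grassmannian_point \<Lambda> "d + e" M d \<iota> U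
    by unfold_locales (simp_all add: assms(4))
  show ?thesis by (rule tangent_space_iso)
qed

end
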